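(* Let $G$ be a unimodular locally compact group. Then its reduced group $C^*$-algebra $C^*_r(G)$ is directly finite.
   Context: Algebras need not be commutative nor have an identity. For $a,b$ in an algebra (or ring) $R$ put $a\bullet b := a+b-ab$. $R$ is called directly finite if for all $a,b\in R$, $a\bullet b=0$ implies $b\bullet a=0$. Fix a left Haar measure on $G$. $C_c(G)$ is the space of continuous compactly supported functions $G\to\mathbb{C}$, an algebra under convolution. $\lambda_2: C_c(G)\to \mathcal{B}(L^2(G))$ is the homomorphism $\lambda_2(f)(h)=f*h$. The reduced group $C^*$-algebra $C^*_r(G)$ is the operator-norm closure of $\lambda_2(C_c(G))$ in $\mathcal{B}(L^2(G))$. *)

theory Defs
  imports "HOL-Analysis.Analysis"
begin

section \<open>Direct finiteness\<close>

text \<open>The multiplication is a parameter, so that the notion applies to algebras of operators,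
  whose product is composition; no unit is required.\<close>

definition circ :: "('r::ab_group_add \<Rightarrow> 'r \<Rightarrow> 'r) \<Rightarrow> 'r \<Rightarrow> 'r \<Rightarrow> 'r"
  where "circ m a b = a + b - m a b"

definition directly_finite :: "('r::ab_group_add \<Rightarrow> 'r \<Rightarrow> 'r) \<Rightarrow> 'r set \<Rightarrow> bool"
  where "directly_finite m R \<longleftrightarrow>
    (\<forall>a\<in>R. \<forall>b\<in>R. circ m a b = 0 \<longrightarrow> circ m b a = 0)"


section \<open>Locally compact groups with a left Haar measure\<close>

text \<open>Groups are written additively, because \<^class>\<open>topological_group_add\<close> is the library's
  class of (not necessarily commutative) topological groups: \<open>x + y\<close> stands for the product
  \<open>xy\<close> and \<open>- x\<close> for the inverse of \<open>x\<close>.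

  A left Haar measure is a nonzero left invariant Radon measure on the Borel sets.  The group need
  not be \<open>\<sigma>\<close>-compact, so regularity is part of the definition; as usual, inner regularity is
  demanded on open sets only.\<close>

definition (in topological_group_add) left_haar_measure :: "'a measure \<Rightarrow> bool"
  where "left_haar_measure \<mu> \<longleftrightarrow>
    space \<mu> = UNIV \<and> sets \<mu> = sigma_sets UNIV {U. open U} \<and>
    emeasure \<mu> UNIV \<noteq> 0 \<and>
    (\<forall>K. compact K \<longrightarrow> emeasure \<mu> K < \<infinity>) \<and>
    (\<forall>A\<in>sets \<mu>. emeasure \<mu> A = (INF U\<in>{U. open U \<and> A \<subseteq> U}. emeasure \<mu> U)) \<and>
    (\<forall>U. open U \<longrightarrow> emeasure \<mu> U = (SUP K\<in>{K. compact K \<and> K \<subseteq> U}. emeasure \<mu> K)) \<and>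
    (\<forall>x. \<forall>A\<in>sets \<mu>. emeasure \<mu> ((\<lambda>y. x + y) ` A) = emeasure \<mu> A)"

text \<open>The fixed left Haar measure is a parameter of the class, so that \<open>L\<^sup>2(G)\<close> can be a type.\<close>

class locally_compact_haar_group = topological_group_add + t2_space +
  fixes haar :: "'a measure"
  assumes locally_compact: "\<exists>U K. open U \<and> compact K \<and> x \<in> U \<and> U \<subseteq> K"
    and left_haar_measure_haar: "left_haar_measure haar"

lemma sets_haar: "sets haar = sets (borel :: 'a::locally_compact_haar_group measure)"
  using left_haar_measure_haar[where 'a='a] by (simp add: left_haar_measure_def borel_def)

definition unimodular :: "'a::locally_compact_haar_group itself \<Rightarrow> bool"
  where "unimodular _ \<longleftrightarrow>
    (\<forall>x::'a. \<forall>A\<in>sets borel. emeasure haar ((\<lambda>y. y + x) ` A) = emeasure haar A)"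


section \<open>The Hilbert space of square integrable functions\<close>

definition square_integrable :: "'a measure \<Rightarrow> ('a \<Rightarrow> complex) \<Rightarrow> bool"
  where "square_integrable M f \<longleftrightarrow>
    f \<in> borel_measurable M \<and> integrable M (\<lambda>x. (cmod (f x))\<^sup>2)"

lemma square_integrable_zero: "square_integrable M (\<lambda>x. 0)"
  by (simp add: square_integrable_def)

lemma square_integrable_scale:
  "square_integrable M f \<Longrightarrow> square_integrable M (\<lambda>x. c * f x)"
  by (auto simp: square_integrable_def norm_mult power_mult_distrib)

lemma square_integrable_inner:
  assumes "square_integrable M f" "square_integrable M g"
  shows "integrable M (\<lambda>x. inner (f x) (g x))"
proof -
  have [measurable]: "f \<in> borel_measurable M" "g \<in> borel_measurable M"
    using assms by (auto simp: square_integrable_def)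
  have "integrable M (\<lambda>x. (cmod (f x))\<^sup>2 + (cmod (g x))\<^sup>2)"
    using assms by (auto simp: square_integrable_def)
  then show ?thesis
  proof (rule Bochner_Integration.integrable_bound)
    show "AE x in M. norm (inner (f x) (g x)) \<le> norm ((cmod (f x))\<^sup>2 + (cmod (g x))\<^sup>2)"
    proof (rule AE_I2)
      fix x
      have "\<bar>inner (f x) (g x)\<bar> \<le> cmod (f x) * cmod (g x)"
        by (rule Cauchy_Schwarz_ineq2)
      also have "\<dots> \<le> (cmod (f x))\<^sup>2 + (cmod (g x))\<^sup>2"
      proof -
        have "2 * (cmod (f x) * cmod (g x)) \<le> (cmod (f x))\<^sup>2 + (cmod (g x))\<^sup>2"
          using sum_squares_bound[of "cmod (f x)" "cmod (g x)"] by (simp add: algebra_simps)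
        moreover have "0 \<le> cmod (f x) * cmod (g x)" by simp
        ultimately show ?thesis by linarith
      qed
      finally show "norm (inner (f x) (g x)) \<le> norm ((cmod (f x))\<^sup>2 + (cmod (g x))\<^sup>2)"
        by simp
    qed
  qed measurable
qed

lemma square_integrable_add:
  assumes "square_integrable M f" "square_integrable M g"
  shows "square_integrable M (\<lambda>x. f x + g x)"
proof -
  have "integrable M (\<lambda>x. (cmod (f x))\<^sup>2 + (cmod (g x))\<^sup>2 + 2 * inner (f x) (g x))"
    using assms square_integrable_inner[OF assms] by (auto simp: square_integrable_def)
  moreover have "(cmod (f x + g x))\<^sup>2 = (cmod (f x))\<^sup>2 + (cmod (g x))\<^sup>2 + 2 * inner (f x) (g x)" for x
    by (simp add: power2_norm_eq_inner inner_add_left inner_add_right inner_commute)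
  ultimately show ?thesis
    using assms by (auto simp: square_integrable_def)
qed

lemma square_integrable_uminus:
  "square_integrable M f \<Longrightarrow> square_integrable M (\<lambda>x. - f x)"
  using square_integrable_scale[of M f "-1"] by simp

lemma square_integrable_diff:
  "square_integrable M f \<Longrightarrow> square_integrable M g \<Longrightarrow> square_integrable M (\<lambda>x. f x - g x)"
  using square_integrable_add[of M f "\<lambda>x. - g x"] square_integrable_uminus[of M g] by simp

definition L2_rel :: "('a::locally_compact_haar_group \<Rightarrow> complex) \<Rightarrow> ('a \<Rightarrow> complex) \<Rightarrow> bool"
  where "L2_rel f g \<longleftrightarrow>
    square_integrable haar f \<and> square_integrable haar g \<and> (AE x in haar. f x = g x)"

quotient_type (overloaded) 'a L2 = "'a::locally_compact_haar_group \<Rightarrow> complex" / partial: L2_rel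
proof (rule part_equivpI)
  show "\<exists>f. L2_rel f f"
    using square_integrable_zero by (auto simp: L2_rel_def)
  show "symp L2_rel"
    by (rule sympI) (auto simp: L2_rel_def eq_commute)
  show "transp L2_rel"
    by (rule transpI) (auto simp: L2_rel_def elim: eventually_elim2)
qed

lift_definition scaleC_L2 :: "complex \<Rightarrow> 'a L2 \<Rightarrow> 'a::locally_compact_haar_group L2"
  is "\<lambda>c f x. c * f x"
  by (auto simp: L2_rel_def square_integrable_scale)

instantiation L2 :: (locally_compact_haar_group) real_inner
begin

lift_definition zero_L2 :: "'a L2" is "\<lambda>x. 0"
  by (simp add: L2_rel_def square_integrable_zero)

lift_definition plus_L2 :: "'a L2 \<Rightarrow> 'a L2 \<Rightarrow> 'a L2" is "\<lambda>f g x. f x + g x"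
  by (auto simp: L2_rel_def square_integrable_add)

lift_definition uminus_L2 :: "'a L2 \<Rightarrow> 'a L2" is "\<lambda>f x. - f x"
  by (auto simp: L2_rel_def square_integrable_uminus)

lift_definition minus_L2 :: "'a L2 \<Rightarrow> 'a L2 \<Rightarrow> 'a L2" is "\<lambda>f g x. f x - g x"
  by (auto simp: L2_rel_def square_integrable_diff)

definition scaleR_L2 :: "real \<Rightarrow> 'a L2 \<Rightarrow> 'a L2"
  where "scaleR_L2 r = scaleC_L2 (complex_of_real r)"

text \<open>The underlying real inner product, that is, the real part of the complex one; it induces
  the same norm.\<close>

lift_definition inner_L2 :: "'a L2 \<Rightarrow> 'a L2 \<Rightarrow> real"
  is "\<lambda>f g. \<integral>x. inner (f x) (g x) \<partial>haar"
  by (rule integral_cong_AE) (auto simp: L2_rel_def square_integrable_def)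

lift_definition norm_L2 :: "'a L2 \<Rightarrow> real"
  is "\<lambda>f. sqrt (\<integral>x. (cmod (f x))\<^sup>2 \<partial>haar)"
  by (rule arg_cong[where f = sqrt], rule integral_cong_AE)
     (auto simp: L2_rel_def square_integrable_def)

definition sgn_L2 :: "'a L2 \<Rightarrow> 'a L2"
  where "sgn_L2 x = inverse (norm x) *\<^sub>R x"

definition dist_L2 :: "'a L2 \<Rightarrow> 'a L2 \<Rightarrow> real"
  where "dist_L2 x y = norm (x - y)"

definition uniformity_L2 :: "('a L2 \<times> 'a L2) filter"
  where "uniformity_L2 = (INF e\<in>{0<..}. principal {(x, y). dist x y < e})"

definition open_L2 :: "'a L2 set \<Rightarrow> bool"
  where "open_L2 U \<longleftrightarrow> (\<forall>x\<in>U. \<forall>\<^sub>F (x', y) in uniformity. x' = x \<longrightarrow> y \<in> U)"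

instance
proof
  fix x y z :: "'a L2" and r s :: real
  show "x + y + z = x + (y + z)"
    by transfer (auto simp: L2_rel_def square_integrable_add algebra_simps)
  show "x + y = y + x"
    by transfer (auto simp: L2_rel_def square_integrable_add algebra_simps)
  show "0 + x = x"
    by transfer (auto simp: L2_rel_def)
  show "- x + x = 0"
    by transfer (auto simp: L2_rel_def square_integrable_zero)
  show "x - y = x + - y"
    by transfer (auto simp: L2_rel_def square_integrable_diff)
  show "r *\<^sub>R (x + y) = r *\<^sub>R x + r *\<^sub>R y"
    unfolding scaleR_L2_def
    by transfer (auto simp: L2_rel_def ring_distribs
        intro!: square_integrable_add square_integrable_scale)
  show "(r + s) *\<^sub>R x = r *\<^sub>R x + s *\<^sub>R x"
    unfolding scaleR_L2_def
    by transfer (auto simp: L2_rel_def ring_distribs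
        intro!: square_integrable_add square_integrable_scale)
  show "r *\<^sub>R s *\<^sub>R x = (r * s) *\<^sub>R x"
    unfolding scaleR_L2_def
    by transfer (auto simp: L2_rel_def mult.assoc intro!: square_integrable_scale)
  show "1 *\<^sub>R x = x"
    unfolding scaleR_L2_def by transfer (auto simp: L2_rel_def)
  show "sgn x = inverse (norm x) *\<^sub>R x" by (rule sgn_L2_def)
  show "dist x y = norm (x - y)" by (rule dist_L2_def)
  show "uniformity = (INF e\<in>{0<..}. principal {(x, y). dist (x::'a L2) y < e})"
    by (rule uniformity_L2_def)
  show "open U \<longleftrightarrow> (\<forall>x\<in>U. \<forall>\<^sub>F (x', y) in uniformity. x' = x \<longrightarrow> y \<in> U)" for U :: "'a L2 set"
    by (rule open_L2_def)
  show "inner x y = inner y x"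
    by transfer (simp only: inner_commute)
  show "inner (x + y) z = inner x z + inner y z"
    by transfer (simp add: inner_add_left L2_rel_def square_integrable_inner)
  have scale: "inner (complex_of_real t * a) b = t * inner a b" for t a b
    by (simp flip: scaleR_conv_of_real)
  show "inner (r *\<^sub>R x) y = r * inner x y"
    unfolding scaleR_L2_def by transfer (simp only: scale integral_mult_right_zero)
  show "0 \<le> inner x x"
    by transfer (simp only: inner_ge_zero Bochner_Integration.integral_nonneg)
  show "inner x x = 0 \<longleftrightarrow> x = 0"
  proof transfer
    fix f :: "'a \<Rightarrow> complex"
    assume f: "L2_rel f f"
    then have "(\<integral>x. (cmod (f x))\<^sup>2 \<partial>haar) = 0 \<longleftrightarrow> (AE x in haar. (cmod (f x))\<^sup>2 = 0)"
      by (intro integral_nonneg_eq_0_iff_AE) (auto simp: L2_rel_def square_integrable_def)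
    then show "(\<integral>x. inner (f x) (f x) \<partial>haar) = 0 \<longleftrightarrow> L2_rel f (\<lambda>x. 0)"
      using f by (simp add: L2_rel_def square_integrable_zero flip: power2_norm_eq_inner)
  qed
  show "norm x = sqrt (inner x x)"
    by transfer (simp only: power2_norm_eq_inner)
qed

end


section \<open>The reduced group C*-algebra\<close>

text \<open>\<open>'a L2 \<Rightarrow>\<^sub>L 'a L2\<close> consists of the bounded real-linear operators, normed by the operator
  norm; \<open>\<B>(L\<^sup>2(G))\<close> is its closed subspace of complex-linear ones.\<close>

definition B_L2 :: "('a::locally_compact_haar_group L2 \<Rightarrow>\<^sub>L 'a L2) set"
  where "B_L2 = {T. \<forall>c h. blinfun_apply T (scaleC_L2 c h) = scaleC_L2 c (blinfun_apply T h)}"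

definition Cc :: "('a::locally_compact_haar_group \<Rightarrow> complex) set"
  where "Cc = {f. continuous_on UNIV f \<and> compact (closure {x. f x \<noteq> 0})}"

text \<open>In multiplicative notation, the integrand is \<open>f(y) h(y\<^sup>-\<^sup>1x)\<close>.\<close>

definition convolution ::
    "('a::locally_compact_haar_group \<Rightarrow> complex) \<Rightarrow> ('a \<Rightarrow> complex) \<Rightarrow> 'a \<Rightarrow> complex"
  where "convolution f h x = (\<integral>y. f y * h (- y + x) \<partial>haar)"

text \<open>For \<open>f \<in> Cc\<close> and square integrable \<open>h\<close>, the convolution \<open>f * h\<close> is defined everywhere, is
  square integrable, does not depend on the representative of \<open>h\<close>, and satisfies
  \<open>\<parallel>f * h\<parallel>\<^sub>2 \<le> \<parallel>f\<parallel>\<^sub>1 \<parallel>h\<parallel>\<^sub>2\<close>.  Hence \<^const>\<open>Blinfun\<close> below is applied to a bounded linear map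
  whenever \<open>f \<in> Cc\<close>.\<close>

definition lambda2 ::
    "('a::locally_compact_haar_group \<Rightarrow> complex) \<Rightarrow> ('a L2 \<Rightarrow>\<^sub>L 'a L2)"
  where "lambda2 f = Blinfun (\<lambda>h. abs_L2 (convolution f (rep_L2 h)))"

definition reduced_group_Cstar :: "('a::locally_compact_haar_group L2 \<Rightarrow>\<^sub>L 'a L2) set"
  where "reduced_group_Cstar = B_L2 \<inter> closure (lambda2 ` Cc)"

end

theory Submission
  imports Defs
begin

text \<open>Let \<open>(1 - a)(1 - b) = 1\<close> and put \<open>x = 1 - \<lambda>(f)\<close> with \<open>f \<in> C\<^sub>c(G)\<close> and \<open>\<lambda>(f)\<close> close to \<open>a\<close>.  The
  right inverse of \<open>1 - a\<close> bounds \<open>x\<^sup>*\<close> from below, so \<open>xx\<^sup>*\<close> is invertible, and the projection \<open>p\<close> onto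
  the kernel of \<open>x\<close> is \<open>1 - x\<^sup>*(xx\<^sup>*)\<^sup>-\<^sup>1x\<close>.  Formally the trace of \<open>p\<close> is that of
  \<open>1 - (xx\<^sup>*)\<^sup>-\<^sup>1xx\<^sup>* = 0\<close>, so \<open>p\<close> should vanish.  To make this rigorous without constructing the trace,
  one represents \<open>p = p\<lambda>(f)\<^sup>*\<close> as left convolution by the vector \<open>pf\<^sup>*\<close>, where
  \<open>f\<^sup>*(x)\<close> is the conjugate of \<open>f(x\<^sup>-\<^sup>1)\<close>, and computes its norm to be \<open>0\<close>, using that the
  operators at hand commute with right convolutions and that \<open>f \<mapsto> f\<^sup>*\<close> is isometric for unimodular
  \<open>G\<close>.  Hence \<open>x\<close> is bounded below by the same constant as \<open>x\<^sup>*\<close>; letting \<open>\<lambda>(f)\<close> tend to \<open>a\<close> shows that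
  \<open>1 - a\<close> is injective, and its right inverse is an inverse.\<close>

section \<open>Haar measure and continuous functions with compact support\<close>

text \<open>Unless \<open>G\<close> is discrete, the identity operator has infinite trace, so the
  formal cancellation for \<open>p\<close> is an indeterminate difference. It becomes an identity
  between finite inner products once an operator is left convolution by a square integrable vector.
  In general neither 1 nor \<open>a\<close> is of this kind, but \<lambda>(f) is, and this is why
  \<open>a\<close> is approximated before \<open>p\<close> is formed. Injectivity would not survive
  the return from \<lambda>(f) to \<open>a\<close>, whereas a lower bound does if its constant is
  fixed before \<open>f\<close> is chosen. Here the constant is
  \<open>1 / (2 * (1 + norm b))\<close>: the norm of \<open>1 - b\<close> is at most
  \<open>1 + norm b\<close>, and the factor 2 leaves room for the approximation error. Commutation
  with right convolutions replaces any use of the von Neumann algebra: an inverse commutes with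
  whatever the operator commutes with. The real part of the inner product suffices throughout, so
  the operator argument is made in an abstract real Hilbert space with an isometric
  involution.\<close>

lemma haar_axioms:
  fixes K :: "'a::locally_compact_haar_group set"
  shows "space haar = (UNIV :: 'a set)" "emeasure haar (UNIV :: 'a set) \<noteq> 0"
    "\<forall>K::'a set. compact K \<longrightarrow> emeasure haar K < \<infinity>"
    "\<forall>A\<in>sets (haar :: 'a measure).
      emeasure haar A = (INF U\<in>{U. open U \<and> A \<subseteq> U}. emeasure haar U)"
    "\<forall>U::'a set. open U \<longrightarrow> emeasure haar U = (SUP K\<in>{K. compact K \<and> K \<subseteq> U}. emeasure haar K)"
    "\<forall>x. \<forall>A\<in>sets (haar :: 'a measure). emeasure haar ((\<lambda>y. x + y) ` A) = emeasure haar A"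
  using left_haar_measure_haar[where 'a='a] unfolding left_haar_measure_def
  by - (elim conjE, assumption)+

lemmas space_haar [simp] = haar_axioms(1)
  and emeasure_haar_UNIV = haar_axioms(2)
  and emeasure_haar_compact = haar_axioms(3)[rule_format]
  and emeasure_haar_outer = haar_axioms(4)[unfolded sets_haar, rule_format]
  and emeasure_haar_inner = haar_axioms(5)[rule_format]
  and emeasure_haar_translate = haar_axioms(6)[unfolded sets_haar, rule_format]

declare sets_haar [simp, measurable_cong]

section \<open>Transformations preserving Haar measure\<close>

definition haar_preserving :: "('a::locally_compact_haar_group \<Rightarrow> 'a) \<Rightarrow> bool"
  where "haar_preserving \<phi> \<longleftrightarrow> \<phi> \<in> measurable haar haar \<and> distr haar haar \<phi> = haar"

lemma haar_preservingI:
  assumes "continuous_on UNIV \<phi>" and "\<And>A. A \<in> sets borel \<Longrightarrow> emeasure haar (\<phi> -` A) = emeasure haar A"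
  shows "haar_preserving \<phi>"
proof -
  have m: "\<phi> \<in> measurable haar haar"
    using borel_measurable_continuous_onI[OF assms(1)] by simp
  moreover have "distr haar haar \<phi> = haar"
    by (rule measure_eqI) (use m assms(2) in \<open>auto simp: emeasure_distr\<close>)
  ultimately show ?thesis by (simp add: haar_preserving_def)
qed

lemma haar_preserving_comp:
  assumes "haar_preserving \<phi>" "haar_preserving \<psi>"
  shows "haar_preserving (\<lambda>x. \<phi> (\<psi> x))"
proof -
  have "(\<lambda>x. \<phi> (\<psi> x)) \<in> measurable haar haar"
    using assms by (auto simp: haar_preserving_def intro: measurable_compose)
  then show ?thesis
    using assms distr_distr[of \<phi> haar haar \<psi> haar] by (simp add: haar_preserving_def comp_def)
qed

lemma haar_preserving_measurable:
  "haar_preserving \<phi> \<Longrightarrow> f \<in> borel_measurable haar \<Longrightarrow> (\<lambda>x. f (\<phi> x)) \<in> borel_measurable haar"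
  unfolding haar_preserving_def by (blast intro: measurable_compose)

lemma haar_preserving_integral:
  fixes f :: "_ \<Rightarrow> 'b::{banach, second_countable_topology}"
  assumes "haar_preserving \<phi>" "f \<in> borel_measurable haar"
  shows "(\<integral>x. f (\<phi> x) \<partial>haar) = (\<integral>x. f x \<partial>haar)"
  using assms integral_distr[of \<phi> haar haar f] by (simp add: haar_preserving_def)

lemma haar_preserving_integrable:
  fixes f :: "_ \<Rightarrow> 'b::{banach, second_countable_topology}"
  assumes "haar_preserving \<phi>" "f \<in> borel_measurable haar"
  shows "integrable haar (\<lambda>x. f (\<phi> x)) \<longleftrightarrow> integrable haar f"
  using assms integrable_distr_eq[of \<phi> haar haar f] by (simp add: haar_preserving_def)

lemma haar_preserving_AE:
  assumes "haar_preserving \<phi>" "AE x in haar. P x"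
  shows "AE x in haar. P (\<phi> x)"
proof -
  obtain N where N: "{x. \<not> P x} \<subseteq> N" "N \<in> null_sets haar"
    using assms(2) by (auto elim!: AE_E simp: null_sets_def)
  have "AE x in distr haar haar \<phi>. x \<notin> N"
    using assms(1) N(2) by (simp add: haar_preserving_def AE_not_in)
  then have "AE x in haar. \<phi> x \<notin> N"
    using assms(1) N(2) by (subst (asm) AE_distr_iff) (auto simp: haar_preserving_def null_sets_def)
  then show ?thesis
    using N(1) by (auto elim!: eventually_mono)
qed

lemma haar_preserving_square_integrable:
  assumes "haar_preserving \<phi>" "square_integrable haar f"
  shows "square_integrable haar (\<lambda>x. f (\<phi> x))"
  using assms haar_preserving_measurable[OF assms(1)]
    haar_preserving_integrable[OF assms(1), of "\<lambda>x. (cmod (f x))\<^sup>2"]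
  by (auto simp: square_integrable_def)

lemma continuous_on_uminus_UNIV: "continuous_on UNIV (\<lambda>x::'a::topological_group_add. - x)"
  by (intro continuous_intros)

lemma haar_preserving_left: "haar_preserving (\<lambda>x. a + x)"
proof (rule haar_preservingI)
  fix A :: "'a set" assume "A \<in> sets borel"
  moreover have "(\<lambda>x. a + x) -` A = (\<lambda>x. - a + x) ` A"
  proof safe
    fix x assume "a + x \<in> A"
    then have "- a + (a + x) \<in> (\<lambda>x. - a + x) ` A" by (rule imageI)
    then show "x \<in> (\<lambda>x. - a + x) ` A" by simp
  qed simp
  ultimately show "emeasure haar ((\<lambda>x. a + x) -` A) = emeasure haar A"
    by (simp add: emeasure_haar_translate)
qed (intro continuous_intros)

lemma haar_preserving_right:
  assumes "unimodular TYPE('a::locally_compact_haar_group)"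
  shows "haar_preserving (\<lambda>x::'a. x + a)"
proof (rule haar_preservingI)
  fix A :: "'a set" assume "A \<in> sets borel"
  moreover have "(\<lambda>x. x + a) -` A = (\<lambda>x. x + - a) ` A"
  proof safe
    fix x assume "x + a \<in> A"
    then have "x + a + - a \<in> (\<lambda>x. x + - a) ` A" by (rule imageI)
    then show "x \<in> (\<lambda>x. x + - a) ` A" by simp
  qed simp
  ultimately show "emeasure haar ((\<lambda>x. x + a) -` A) = emeasure haar A"
    using assms unfolding unimodular_def by metis
qed (intro continuous_intros)

section \<open>Cutoff functions and compactly supported functions\<close>

lemma compact_neighbourhood:
  fixes K :: "'a::locally_compact_haar_group set"
  assumes "compact K"
  obtains V C where "open V" "compact C" "K \<subseteq> V" "V \<subseteq> C"
proof -
  have "\<forall>x::'a. \<exists>U C. open U \<and> compact C \<and> x \<in> U \<and> U \<subseteq> C"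
    using locally_compact by blast
  then obtain U C where UC: "\<And>x::'a. open (U x) \<and> compact (C x) \<and> x \<in> U x \<and> U x \<subseteq> C x"
    unfolding choice_iff by blast
  obtain I where I: "I \<subseteq> K" "finite I" "K \<subseteq> (\<Union>x\<in>I. U x)"
    using compactE_image[OF assms, of K U] UC by blast
  show ?thesis
    by (rule that[of "\<Union>x\<in>I. U x" "\<Union>x\<in>I. C x"]) (use UC I in \<open>auto intro!: compact_UN\<close>)
qed

lemma compact_subset_of_vanishing:
  fixes f :: "'a::t2_space \<Rightarrow> 'b::zero"
  assumes "compact K" "\<And>x. x \<notin> K \<Longrightarrow> f x = 0"
  shows "compact (closure {x. f x \<noteq> 0})"
proof -
  have "closure {x. f x \<noteq> 0} \<subseteq> K"
    by (rule closure_minimal) (use assms compact_imp_closed in auto)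
  then show ?thesis
    using compact_Int_closed[OF assms(1) closed_closure] by (metis inf.absorb_iff2)
qed

lemma CcI:
  "continuous_on UNIV f \<Longrightarrow> compact K \<Longrightarrow> (\<And>x. x \<notin> K \<Longrightarrow> f x = 0) \<Longrightarrow> f \<in> Cc"
  unfolding Cc_def by (simp add: compact_subset_of_vanishing)

lemma CcE:
  assumes "f \<in> Cc"
  obtains K where "continuous_on UNIV f" "compact K" "\<And>x. x \<notin> K \<Longrightarrow> f x = 0"
proof (rule that[of "closure {x. f x \<noteq> 0}"])
  show "continuous_on UNIV f" "compact (closure {x. f x \<noteq> 0})"
    using assms by (auto simp: Cc_def)
  show "f x = 0" if "x \<notin> closure {x. f x \<noteq> 0}" for x
    using that closure_subset[of "{x. f x \<noteq> 0}"] by blast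
qed

text \<open>A locally compact Hausdorff space is completely regular, so \<open>K\<close> can be
  separated from the complement of \<open>U \<inter> V\<close>, where \<open>V\<close> is an open
  neighbourhood of \<open>K\<close> inside a compact set \<open>C\<close>. Shrinking
  \<open>U\<close> by \<open>V\<close> is what confines the function to a compact set.\<close>

lemma Urysohn_cutoff:
  fixes K U :: "'a::locally_compact_haar_group set"
  assumes "compact K" "open U" "K \<subseteq> U"
  obtains f :: "'a \<Rightarrow> real" and C where "continuous_on UNIV f" "\<And>x. 0 \<le> f x" "\<And>x. f x \<le> 1"
    "\<And>x. x \<in> K \<Longrightarrow> f x = 1" "compact C" "\<And>x. x \<notin> C \<inter> U \<Longrightarrow> f x = 0"
proof -
  obtain V C where VC: "open V" "compact C" "K \<subseteq> V" "V \<subseteq> C"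
    using compact_neighbourhood[OF assms(1)] by blast
  have "locally_compact_space (euclidean :: 'a topology)"
    unfolding locally_compact_space_def using locally_compact[where 'a='a] by auto
  then have "completely_regular_space (euclidean :: 'a topology)"
    by (rule locally_compact_regular_imp_completely_regular_space)
      (simp add: Hausdorff_space_def disjnt_def, metis hausdorff)
  then obtain f :: "'a \<Rightarrow> real" where
    f: "continuous_map euclidean (top_of_set {0..1}) f" "f ` (- (U \<inter> V)) \<subseteq> {0}" "f ` K \<subseteq> {1}"
  proof -
    have "compactin euclidean K" "closedin euclidean (- (U \<inter> V))" "disjnt K (- (U \<inter> V))"
      using assms VC by (auto simp: disjnt_def closed_Compl)
    with \<open>completely_regular_space (euclidean :: 'a topology)\<close> show ?thesis
      using Urysohn_completely_regular_compact_closed[of 0 1 "euclidean :: 'a topology" K "- (U \<inter> V)"] that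
      by (metis zero_le_one)
  qed
  show ?thesis
  proof (rule that[of f C])
    show "continuous_on UNIV f" "0 \<le> f x" "f x \<le> 1" for x
      using f(1) by (auto simp: continuous_map_in_subtopology image_subset_iff Pi_iff)
    show "f x = 1" if "x \<in> K" for x
      using f(3) that by blast
    show "f x = 0" if "x \<notin> C \<inter> U" for x
      using f(2) VC(4) that by blast
  qed fact
qed

lemma compact_support_integrable:
  fixes f :: "'a::locally_compact_haar_group \<Rightarrow> 'b::{banach, second_countable_topology}"
  assumes f: "continuous_on UNIV f" and K: "compact K" "\<And>x. x \<notin> K \<Longrightarrow> f x = 0"
  shows "integrable haar f"
proof -
  have "compact (f ` K)"
    using f K(1) by (meson compact_continuous_image continuous_on_subset subset_UNIV)
  then obtain B where B: "\<And>x. x \<in> K \<Longrightarrow> norm (f x) \<le> B"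
    by (metis bounded_iff compact_imp_bounded image_eqI)
  have "integrable haar (\<lambda>x. B * indicator K x)"
    using emeasure_haar_compact[OF K(1)] compact_imp_closed[OF K(1)] by simp
  then show ?thesis
  proof (rule Bochner_Integration.integrable_bound)
    show "f \<in> borel_measurable haar"
      using borel_measurable_continuous_onI[OF f] by simp
    show "AE x in haar. norm (f x) \<le> norm (B * indicator K x)"
      using B K(2) by (intro AE_I2) (force simp: indicator_def)
  qed
qed

lemma Cc_measurable: "f \<in> Cc \<Longrightarrow> f \<in> borel_measurable haar"
  using borel_measurable_continuous_onI[of f] by (simp add: Cc_def cong: measurable_cong_sets)

lemma Cc_integrable: "f \<in> Cc \<Longrightarrow> integrable haar f"
  using compact_support_integrable by (metis CcE)

lemma Cc_square_integrable:
  assumes "f \<in> Cc" shows "square_integrable haar f"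
proof -
  obtain K where K: "continuous_on UNIV f" "compact K" "\<And>x. x \<notin> K \<Longrightarrow> f x = 0"
    using CcE[OF assms] by blast
  have "integrable haar (\<lambda>x. (cmod (f x))\<^sup>2)"
    by (rule compact_support_integrable[OF _ K(2)]) (use K in \<open>auto intro!: continuous_intros\<close>)
  then show ?thesis
    using Cc_measurable[OF assms] by (simp add: square_integrable_def)
qed

lemma compact_plus_set:
  fixes K L :: "'a::topological_group_add set"
  assumes "compact K" "compact L"
  shows "compact ((\<lambda>p. fst p + snd p) ` (K \<times> L))" "compact ((\<lambda>p. fst p - snd p) ` (K \<times> L))"
  by (auto intro!: compact_continuous_image compact_Times assms continuous_intros)

lemma compact_uminus_image: "compact (K :: 'a::topological_group_add set) \<Longrightarrow> compact (uminus ` K)"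
  by (auto intro!: compact_continuous_image continuous_intros)

section \<open>Parametric integrals and interchange of integrals\<close>

lemma norm_integral_compact_le:
  fixes f :: "'a::locally_compact_haar_group \<Rightarrow> 'b::{banach, second_countable_topology}"
  assumes "compact L" "0 \<le> B" "\<And>x. norm (f x) \<le> B * indicator L x"
  shows "norm (\<integral>x. f x \<partial>haar) \<le> B * measure haar L"
proof -
  have L: "L \<in> sets haar" "emeasure haar L < \<infinity>"
    using compact_imp_closed[OF assms(1)] emeasure_haar_compact[OF assms(1)] by auto
  \<comment> \<open>If \<open>f\<close> is not integrable, its integral is 0 by convention and the
    estimate still holds.\<close>
  have "norm (\<integral>x. f x \<partial>haar) \<le> (\<integral>x. norm (f x) \<partial>haar)"
    by (rule integral_norm_bound)
  also have "\<dots> \<le> (\<integral>x. B * indicator L x \<partial>haar)"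
    by (rule integral_mono') (use L assms in auto)
  also have "\<dots> = B * measure haar L"
    using L by simp
  finally show ?thesis .
qed

text \<open>The tube lemma: compactness of \<open>L\<close> makes the continuity in the parameter
  uniform over \<open>L\<close>.\<close>

lemma parametric_uniform:
  fixes F :: "'a::topological_space \<Rightarrow> 'b::topological_space \<Rightarrow> 'c::real_normed_vector"
  assumes "continuous_on UNIV (\<lambda>p. F (fst p) (snd p))" "compact L" "e > 0"
  obtains X where "x0 \<in> X" "open X" "\<And>x y. x \<in> X \<Longrightarrow> y \<in> L \<Longrightarrow> norm (F x y - F x0 y) \<le> e"
proof -
  have "continuous_on (UNIV \<times> L) (\<lambda>p. F (fst p) (snd p))"
    using assms(1) by (rule continuous_on_subset) simp
  then obtain X where "x0 \<in> X" "open X"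
    "\<forall>x\<in>X \<inter> UNIV. \<forall>t\<in>L. dist (F (fst (x, t)) (snd (x, t))) (F (fst (x0, t)) (snd (x0, t))) \<le> e"
    by (rule continuous_on_prod_compactE[OF _ assms(2) UNIV_I assms(3)])
  then show ?thesis
    by (intro that[of X]) (simp_all add: dist_norm)
qed

lemma continuous_on_section:
  assumes "continuous_on UNIV (\<lambda>p. F (fst p) (snd p))"
  shows "continuous_on UNIV (F x)" "continuous_on UNIV (\<lambda>x. F x y)"
  using continuous_on_compose2[OF assms, of UNIV "\<lambda>y. (x, y)"]
    continuous_on_compose2[OF assms, of UNIV "\<lambda>x. (x, y)"]
  by (simp_all add: continuous_intros)

lemma continuous_on_parametric_integral:
  fixes F :: "'c::t2_space \<Rightarrow> 'a::locally_compact_haar_group \<Rightarrow> 'b::{banach, second_countable_topology}"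
  assumes F: "continuous_on UNIV (\<lambda>p. F (fst p) (snd p))"
    and L: "compact L" "\<And>x y. y \<notin> L \<Longrightarrow> F x y = 0"
  shows "continuous_on UNIV (\<lambda>x. \<integral>y. F x y \<partial>haar)"
  unfolding continuous_on_eq_continuous_at[OF open_UNIV] continuous_at
proof (intro ballI tendstoI)
  fix x0 and e :: real assume "e > 0"
  \<comment> \<open>The summand 1 keeps the denominator positive when \<open>L\<close> is a null
    set; the factor 2 makes the final estimate strict.\<close>
  define d where "d = e / (2 * (measure haar L + 1))"
  have "d > 0" using \<open>e > 0\<close> by (simp add: d_def add_nonneg_pos)
  obtain X where X: "x0 \<in> X" "open X" "\<And>x y. x \<in> X \<Longrightarrow> y \<in> L \<Longrightarrow> norm (F x y - F x0 y) \<le> d"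
    using parametric_uniform[OF F L(1) \<open>d > 0\<close>, of x0] by blast
  have int: "integrable haar (F x)" for x
    using continuous_on_section(1)[OF F] L by (rule compact_support_integrable)
  have "dist (\<integral>y. F x y \<partial>haar) (\<integral>y. F x0 y \<partial>haar) < e" if "x \<in> X" for x
  proof -
    have "dist (\<integral>y. F x y \<partial>haar) (\<integral>y. F x0 y \<partial>haar) = norm (\<integral>y. F x y - F x0 y \<partial>haar)"
      using int by (simp add: dist_norm)
    also have "\<dots> \<le> d * measure haar L"
      by (rule norm_integral_compact_le) (use L X(3)[OF that] \<open>d > 0\<close> in \<open>auto simp: indicator_def\<close>)
    also have "\<dots> \<le> d * (measure haar L + 1)"
      using \<open>d > 0\<close> by simp
    also have "\<dots> = e / 2"
      unfolding d_def by (simp add: field_simps add_nonneg_eq_0_iff)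
    also have "\<dots> < e" using \<open>e > 0\<close> by simp
    finally show ?thesis .
  qed
  then show "\<forall>\<^sub>F x in at x0. dist (\<integral>y. F x y \<partial>haar) (\<integral>y. F x0 y \<partial>haar) < e"
    using X(1,2) unfolding eventually_at_topological by blast
qed

text \<open>Finitely many tubes cover \<open>K\<close>, and making them disjoint gives a Borel
  partition of \<open>K\<close>. Thus \<open>F\<close> is uniformly close on
  \<open>K \<times> L\<close> to a finite sum of indicators times sections, for which both iterated
  integrals can be computed directly.\<close>

lemma compact_parametric_step_function:
  fixes F :: "'a::t2_space \<Rightarrow> 'b::topological_space \<Rightarrow> 'c::real_normed_vector"
  assumes F: "continuous_on UNIV (\<lambda>p. F (fst p) (snd p))"
    and "compact K" "compact L" "e > 0"
  obtains n :: nat and E g where "\<And>i. E i \<in> sets borel" "\<And>i. E i \<subseteq> K" "disjoint_family E"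
    "K = (\<Union>i<n. E i)" "\<And>i x y. x \<in> E i \<Longrightarrow> y \<in> L \<Longrightarrow> norm (F x y - F (g i) y) \<le> e"
proof -
  have "\<forall>x0. \<exists>X. x0 \<in> X \<and> open X \<and> (\<forall>x\<in>X. \<forall>y\<in>L. norm (F x y - F x0 y) \<le> e)"
  proof
    fix x0
    show "\<exists>X. x0 \<in> X \<and> open X \<and> (\<forall>x\<in>X. \<forall>y\<in>L. norm (F x y - F x0 y) \<le> e)"
      by (rule parametric_uniform[OF F assms(3,4), of x0]) blast
  qed
  then obtain X where X: "\<And>x0. x0 \<in> X x0" "\<And>x0. open (X x0)"
    "\<And>x0 x y. x \<in> X x0 \<Longrightarrow> y \<in> L \<Longrightarrow> norm (F x y - F x0 y) \<le> e"
    unfolding choice_iff by blast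
  obtain I where I: "I \<subseteq> K" "finite I" "K \<subseteq> (\<Union>x\<in>I. X x)"
    using compactE_image[OF assms(2), of K X] X by blast
  obtain n :: nat and g where g: "I = g ` {i. i < n}"
    using finite_imp_nat_seg_image_inj_on[OF I(2)] by blast
  define A where "A i = (if i < n then X (g i) \<inter> K else {})" for i
  have "A i \<in> sets borel" for i
    using X(2) compact_imp_closed[OF assms(2)] by (auto simp: A_def)
  then have "disjointed A i \<in> sets borel" for i
    using sets.range_disjointed_sets[of A borel] by auto
  moreover have sub: "disjointed A i \<subseteq> A i" for i by (rule disjointed_subset)
  moreover have "K = (\<Union>i<n. disjointed A i)"
  proof -
    have "K = (\<Union>i. A i)"
      using I(3) g by (fastforce simp: A_def split: if_splits)
    also have "\<dots> = (\<Union>i. disjointed A i)" by (simp add: UN_disjointed_eq)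
    also have "\<dots> = (\<Union>i<n. disjointed A i)"
      using sub by (fastforce simp: A_def split: if_splits)
    finally show ?thesis .
  qed
  moreover have "disjointed A i \<subseteq> K" for i
    using sub[of i] by (auto simp: A_def split: if_splits)
  moreover have "norm (F x y - F (g i) y) \<le> e" if "x \<in> disjointed A i" "y \<in> L" for x y i
    using sub[of i] that X(3) by (auto simp: A_def split: if_splits)
  ultimately show ?thesis
    using that[of "disjointed A" n g] disjoint_family_disjointed by blast
qed

text \<open>The Haar measure need not be \<open>\<sigma>\<close>-finite, and the product \<open>\<sigma>\<close>-algebra may be smaller than
  the Borel \<open>\<sigma>\<close>-algebra of the product, so the library version does not apply.\<close>

lemma haar_Fubini:
  fixes F :: "'a::locally_compact_haar_group \<Rightarrow> 'a \<Rightarrow> 'b::{banach, second_countable_topology}"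
  assumes F: "continuous_on UNIV (\<lambda>p. F (fst p) (snd p))"
    and K: "compact K" and L: "compact L"
    and 0: "\<And>x y. x \<notin> K \<Longrightarrow> F x y = 0" "\<And>x y. y \<notin> L \<Longrightarrow> F x y = 0"
  shows "(\<integral>x. \<integral>y. F x y \<partial>haar \<partial>haar) = (\<integral>y. \<integral>x. F x y \<partial>haar \<partial>haar)"
proof -
  let ?m = "measure haar K * measure haar L"
  have F': "continuous_on UNIV (\<lambda>p. F (snd p) (fst p))"
    using continuous_on_compose2[OF F, of UNIV "\<lambda>p. (snd p, fst p)"] by (simp add: continuous_intros)
  have int: "integrable haar (F x)" "integrable haar (\<lambda>x. F x y)" for x y
    using compact_support_integrable[OF continuous_on_section(1)[OF F] L 0(2)]
      compact_support_integrable[OF continuous_on_section(2)[OF F] K 0(1)] by auto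
  have int2: "integrable haar (\<lambda>x. \<integral>y. F x y \<partial>haar)"
    by (rule compact_support_integrable[OF continuous_on_parametric_integral[OF F L] K]) (use 0 in auto)
  have int3: "integrable haar (\<lambda>y. \<integral>x. F x y \<partial>haar)"
    by (rule compact_support_integrable[OF continuous_on_parametric_integral[OF F' K] L]) (use 0 in auto)
  have *: "norm ((\<integral>x. \<integral>y. F x y \<partial>haar \<partial>haar) - (\<integral>y. \<integral>x. F x y \<partial>haar \<partial>haar)) \<le> 2 * (e * ?m)"
    if "e > 0" for e
  proof -
    obtain n :: nat and E g where E: "\<And>i. E i \<in> sets borel" "\<And>i. E i \<subseteq> K" "disjoint_family E"
      "K = (\<Union>i<n. E i)" and g: "\<And>i x y. x \<in> E i \<Longrightarrow> y \<in> L \<Longrightarrow> norm (F x y - F (g i) y) \<le> e"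
      by (rule compact_parametric_step_function[OF F K L \<open>e > 0\<close>], rule that)
    have fin: "emeasure haar (E i) < \<infinity>" for i
      using emeasure_mono[OF E(2)[of i], of haar] emeasure_haar_compact[OF K] compact_imp_closed[OF K]
      by auto
    define G where "G x y = (\<Sum>i<n. indicator (E i) x *\<^sub>R F (g i) y)" for x y
    have ind: "integrable haar (indicator (E i) :: 'a \<Rightarrow> real)" for i
      using E(1) fin by simp
    have G_int: "integrable haar (G x)" "integrable haar (\<lambda>x. G x y)" for x y
      unfolding G_def
      by (intro Bochner_Integration.integrable_sum integrable_scaleR_right int)
        (intro Bochner_Integration.integrable_sum integrable_scaleR_left ind)
    have Gy: "(\<integral>y. G x y \<partial>haar) = (\<Sum>i<n. indicator (E i) x *\<^sub>R (\<integral>y. F (g i) y \<partial>haar))" for x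
      unfolding G_def
      by (subst Bochner_Integration.integral_sum, rule integrable_scaleR_right[OF int(1)])
        (rule sum.cong[OF refl], simp)
    have Gx: "(\<integral>x. G x y \<partial>haar) = (\<Sum>i<n. measure haar (E i) *\<^sub>R F (g i) y)" for y
      unfolding G_def
      by (subst Bochner_Integration.integral_sum, rule integrable_scaleR_left[OF ind])
        (rule sum.cong[OF refl], use E(1) fin in simp)
    have Gyx: "(\<integral>x. \<integral>y. G x y \<partial>haar \<partial>haar) = (\<Sum>i<n. measure haar (E i) *\<^sub>R (\<integral>y. F (g i) y \<partial>haar))"
      unfolding Gy
      by (subst Bochner_Integration.integral_sum, rule integrable_scaleR_left[OF ind])
        (rule sum.cong[OF refl], use E(1) fin in simp)
    have Gxy: "(\<integral>y. \<integral>x. G x y \<partial>haar \<partial>haar) = (\<Sum>i<n. measure haar (E i) *\<^sub>R (\<integral>y. F (g i) y \<partial>haar))"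
      unfolding Gx
      by (subst Bochner_Integration.integral_sum, rule integrable_scaleR_right[OF int(1)])
        (rule sum.cong[OF refl], simp)
    have Gy_int: "integrable haar (\<lambda>x. \<integral>y. G x y \<partial>haar)"
      unfolding Gy by (intro Bochner_Integration.integrable_sum integrable_scaleR_left ind)
    have Gx_int: "integrable haar (\<lambda>y. \<integral>x. G x y \<partial>haar)"
      unfolding Gx by (intro Bochner_Integration.integrable_sum integrable_scaleR_right int)
    have diff: "norm (F x y - G x y) \<le> e * indicator K x * indicator L y" for x y
    proof (cases "x \<in> K \<and> y \<in> L")
      case True
      then obtain i where i: "i < n" "x \<in> E i" using E(4) by auto
      have "indicator (E j) x = (if j = i then 1 else 0 :: real)" for j
        using i E(3) by (auto simp: disjoint_family_on_def indicator_def)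
      then have "G x y = F (g i) y"
        using i(1) by (simp only: G_def if_distribR if_distrib[of "\<lambda>c. c *\<^sub>R _"] scaleR_one scaleR_zero_left)
          (simp add: sum.delta)
      then show ?thesis using True i g by simp
    next
      case False
      have "F (g i) y = 0" if "y \<notin> L" for i using that 0(2) by blast
      moreover have "x \<notin> E i" if "x \<notin> K" for i using that E(2) by blast
      ultimately have "G x y = 0"
        unfolding G_def using False by (intro sum.neutral) (auto simp: indicator_def)
      then show ?thesis using False 0 by auto
    qed
    have "norm ((\<integral>x. \<integral>y. F x y \<partial>haar \<partial>haar) - (\<integral>x. \<integral>y. G x y \<partial>haar \<partial>haar))
        = norm (\<integral>x. (\<integral>y. F x y - G x y \<partial>haar) \<partial>haar)"
      using int G_int int2 Gy_int by simp
    also have "\<dots> \<le> (e * measure haar L) * measure haar K"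
    proof (rule norm_integral_compact_le[OF K])
      show "norm (\<integral>y. F x y - G x y \<partial>haar) \<le> e * measure haar L * indicator K x" for x
        using norm_integral_compact_le[OF L, of "e * indicator K x" "\<lambda>y. F x y - G x y"] diff \<open>e > 0\<close>
        by (simp add: ac_simps)
    qed (use \<open>e > 0\<close> in simp)
    finally have 1: "norm ((\<integral>x. \<integral>y. F x y \<partial>haar \<partial>haar) - (\<integral>x. \<integral>y. G x y \<partial>haar \<partial>haar)) \<le> e * ?m"
      by (simp add: ac_simps)
    have "norm ((\<integral>y. \<integral>x. F x y \<partial>haar \<partial>haar) - (\<integral>y. \<integral>x. G x y \<partial>haar \<partial>haar))
        = norm (\<integral>y. (\<integral>x. F x y - G x y \<partial>haar) \<partial>haar)"
      using int G_int int3 Gx_int by simp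
    also have "\<dots> \<le> (e * measure haar K) * measure haar L"
    proof (rule norm_integral_compact_le[OF L])
      show "norm (\<integral>x. F x y - G x y \<partial>haar) \<le> e * measure haar K * indicator L y" for y
        using norm_integral_compact_le[OF K, of "e * indicator L y" "\<lambda>x. F x y - G x y"] diff \<open>e > 0\<close>
        by (simp add: ac_simps)
    qed (use \<open>e > 0\<close> in simp)
    finally have 2: "norm ((\<integral>y. \<integral>x. F x y \<partial>haar \<partial>haar) - (\<integral>y. \<integral>x. G x y \<partial>haar \<partial>haar)) \<le> e * ?m"
      by (simp add: ac_simps)
    show ?thesis
      using norm_triangle_ineq4[of "(\<integral>x. \<integral>y. F x y \<partial>haar \<partial>haar) - (\<integral>x. \<integral>y. G x y \<partial>haar \<partial>haar)"
        "(\<integral>y. \<integral>x. F x y \<partial>haar \<partial>haar) - (\<integral>y. \<integral>x. G x y \<partial>haar \<partial>haar)"] 1 2 Gyx Gxy by simp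
  qed
  have "norm ((\<integral>x. \<integral>y. F x y \<partial>haar \<partial>haar) - (\<integral>y. \<integral>x. F x y \<partial>haar \<partial>haar)) \<le> 0 + e" if "e > 0" for e
  proof -
    define c where "c = e / (2 * (?m + 1))"
    have c: "c > 0" using that by (simp add: c_def add_nonneg_pos)
    have "?m + 1 \<noteq> 0" by (simp add: add_nonneg_eq_0_iff)
    then have "e = 2 * (c * (?m + 1))" by (simp add: c_def field_simps)
    then have "2 * (c * ?m) \<le> e" using c by (simp add: distrib_left)
    then show ?thesis using *[OF c] by simp
  qed
  then have "norm ((\<integral>x. \<integral>y. F x y \<partial>haar \<partial>haar) - (\<integral>y. \<integral>x. F x y \<partial>haar \<partial>haar)) \<le> 0"
    by (rule field_le_epsilon)
  then show ?thesis by simp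
qed

section \<open>Invariance of Haar measure under inversion\<close>

lemma compact_support_integral_uminus:
  fixes f :: "'a::locally_compact_haar_group \<Rightarrow> real"
  assumes uni: "unimodular TYPE('a)"
    and f: "continuous_on UNIV f" "compact K" "\<And>x. x \<notin> K \<Longrightarrow> f x = 0"
  shows "(\<integral>x. f (- x) \<partial>haar) = (\<integral>x. f x \<partial>haar)"
proof -
  \<comment> \<open>A compact set of positive measure is needed for an auxiliary \<open>g\<close>
    with nonzero integral, which is cancelled at the end. Inner regularity of the whole group
    provides it.\<close>
  have "\<exists>H::'a set. compact H \<and> emeasure haar H > 0"
  proof (rule ccontr)
    assume "\<not> ?thesis"
    then have "(SUP K\<in>{K. compact K \<and> K \<subseteq> (UNIV :: 'a set)}. emeasure haar K) \<le> 0"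
      by (intro SUP_least) auto
    then show False
      using emeasure_haar_inner[OF open_UNIV, where 'a='a] emeasure_haar_UNIV[where 'a='a] by simp
  qed
  then obtain H :: "'a set" where H: "compact H" "emeasure haar H > 0" by blast
  obtain g :: "'a \<Rightarrow> real" and L where g: "continuous_on UNIV g" "\<And>x. 0 \<le> g x"
    "\<And>x. x \<in> H \<Longrightarrow> g x = 1" "compact L" "\<And>x. x \<notin> L \<Longrightarrow> g x = 0"
    using Urysohn_cutoff[OF H(1) open_UNIV] by (metis Int_UNIV_right subset_UNIV)
  have g_int: "integrable haar g"
    by (rule compact_support_integrable[OF g(1,4,5)])
  have H': "H \<in> sets haar" "emeasure haar H < \<infinity>"
    using H(1) compact_imp_closed[OF H(1)] emeasure_haar_compact[OF H(1)] by auto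
  have "0 < measure haar H"
    using H(2) H' by (simp add: measure_def enn2real_positive_iff)
  also have "measure haar H = (\<integral>x. indicator H x \<partial>haar)"
    using H' by simp
  also have "\<dots> \<le> (\<integral>x. g x \<partial>haar)"
    by (rule integral_mono'[OF g_int]) (use g in \<open>auto simp: indicator_def\<close>)
  finally have g_pos: "(\<integral>x. g x \<partial>haar) > 0" .
  have meas: "f \<in> borel_measurable haar" "g \<in> borel_measurable haar"
    using borel_measurable_continuous_onI[OF f(1)] borel_measurable_continuous_onI[OF g(1)] by simp_all
  let ?D = "(\<lambda>p. fst p - snd p) ` (L \<times> K)"
  have cf: "continuous_on A (\<lambda>x. f (h x))" "continuous_on A (\<lambda>x. g (h x))"
    if "continuous_on A h" for A :: "('a \<times> 'a) set" and h
    using continuous_on_compose2[OF f(1) that] continuous_on_compose2[OF g(1) that] by auto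
  have cf1: "continuous_on A (\<lambda>x. f (h x))" "continuous_on A (\<lambda>x. g (h x))"
    if "continuous_on A h" for A :: "'a set" and h
    using continuous_on_compose2[OF f(1) that] continuous_on_compose2[OF g(1) that] by auto
  have D: "compact ?D" using compact_plus_set(2)[OF g(4) f(2)] .
  \<comment> \<open>The integral of \<open>g\<close> is first rewritten by right invariance with
    \<open>g (y + x)\<close>; left invariance then moves the shift to \<open>f (- y + x)\<close>,
    and translating \<open>y\<close> by \<open>x\<close> leaves \<open>f (- y)\<close>. The
    difference set \<open>?D\<close> bounds the support in \<open>y\<close> for both
    interchanges.\<close>
  have "(\<integral>x. f x \<partial>haar) * (\<integral>x. g x \<partial>haar) = (\<integral>x. f x * (\<integral>y. g y \<partial>haar) \<partial>haar)"
    by simp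
  also have "\<dots> = (\<integral>x. \<integral>y. f x * g (y + x) \<partial>haar \<partial>haar)"
    using haar_preserving_integral[OF haar_preserving_right[OF uni] meas(2)] by simp
  also have "\<dots> = (\<integral>y. \<integral>x. f x * g (y + x) \<partial>haar \<partial>haar)"
  proof (rule haar_Fubini[OF _ f(2) D])
    show "continuous_on UNIV (\<lambda>p. f (fst p) * g (snd p + fst p))"
      by (intro continuous_intros cf)
    show "f x * g (y + x) = 0" if "x \<notin> K" for x y using f(3)[OF that] by simp
    show "f x * g (y + x) = 0" if "y \<notin> ?D" for x y
    proof (rule ccontr)
      assume "f x * g (y + x) \<noteq> 0"
      then have "x \<in> K" "y + x \<in> L" using f(3) g(5) by auto
      then have "(y + x) - x \<in> ?D" by force
      with that show False by simp
    qed
  qed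
  also have "\<dots> = (\<integral>y. \<integral>x. f (- y + x) * g x \<partial>haar \<partial>haar)"
  proof (rule Bochner_Integration.integral_cong[OF refl])
    fix y
    have "(\<lambda>x. f x * g (y + x)) \<in> borel_measurable haar"
      using borel_measurable_continuous_onI[of "\<lambda>x. f x * g (y + x)"]
      by (simp add: continuous_intros cf1 f(1))
    from haar_preserving_integral[OF haar_preserving_left[of "- y"] this]
    show "(\<integral>x. f x * g (y + x) \<partial>haar) = (\<integral>x. f (- y + x) * g x \<partial>haar)" by simp
  qed
  also have "\<dots> = (\<integral>x. \<integral>y. f (- y + x) * g x \<partial>haar \<partial>haar)"
  proof (rule haar_Fubini[OF _ D g(4)])
    show "continuous_on UNIV (\<lambda>p. f (- fst p + snd p) * g (snd p))"
      by (intro continuous_intros cf)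
    show "f (- y + x) * g x = 0" if "x \<notin> L" for x y using g(5)[OF that] by simp
    show "f (- y + x) * g x = 0" if "y \<notin> ?D" for x y
    proof (rule ccontr)
      assume "f (- y + x) * g x \<noteq> 0"
      then have "- y + x \<in> K" "x \<in> L" using f(3) g(5) by auto
      then have "x - (- y + x) \<in> ?D" by force
      with that show False by (simp add: diff_conv_add_uminus minus_add del: add_uminus_conv_diff)
    qed
  qed
  also have "\<dots> = (\<integral>x. g x * (\<integral>y. f (- y) \<partial>haar) \<partial>haar)"
  proof (rule Bochner_Integration.integral_cong[OF refl])
    fix x
    have "(\<lambda>y. f (- y + x)) \<in> borel_measurable haar"
      using borel_measurable_continuous_onI[of "\<lambda>y. f (- y + x)"] by (simp add: continuous_intros cf1)
    from haar_preserving_integral[OF haar_preserving_left[of x] this]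
    show "(\<integral>y. f (- y + x) * g x \<partial>haar) = g x * (\<integral>y. f (- y) \<partial>haar)"
      by (simp add: minus_add add.assoc)
  qed
  also have "\<dots> = (\<integral>x. f (- x) \<partial>haar) * (\<integral>x. g x \<partial>haar)"
    by simp
  finally show ?thesis using g_pos by simp
qed

text \<open>Cutoff functions carry the invariance of integrals to open sets by inner regularity, and
  outer regularity carries it to Borel sets. Each passage gives only an inequality; as inversion is
  an involution, the same inequality for the inverted set is the reverse one.\<close>

lemma haar_preserving_uminus:
  assumes uni: "unimodular TYPE('a::locally_compact_haar_group)"
  shows "haar_preserving (\<lambda>x::'a. - x)"
proof (rule haar_preservingI)
  have vim: "uminus -` A = uminus ` A" for A :: "'a set"
    by (auto intro: image_eqI[of _ _ "- _"])
  have open_le: "emeasure haar (uminus -` U) \<le> emeasure haar U" if U: "open U" for U :: "'a set"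
  proof -
    have mU: "open (uminus -` U)"
      using continuous_on_uminus_UNIV[where 'a='a] U by (simp add: continuous_on_open_vimage)
    show ?thesis
      unfolding emeasure_haar_inner[OF mU]
    proof (rule SUP_least, clarify)
      fix K assume K: "compact K" "K \<subseteq> uminus -` U"
      obtain f :: "'a \<Rightarrow> real" and C where f: "continuous_on UNIV f" "\<And>x. 0 \<le> f x" "\<And>x. f x \<le> 1"
        "\<And>x. x \<in> K \<Longrightarrow> f x = 1" "compact C" "\<And>x. x \<notin> C \<inter> uminus -` U \<Longrightarrow> f x = 0"
        by (rule Urysohn_cutoff[OF K(1) mU K(2)]) blast
      have f0: "f x = 0" if "x \<notin> C" for x using f(6) that by blast
      have f_int: "integrable haar f" by (rule compact_support_integrable[OF f(1,5) f0])
      have f_int': "integrable haar (\<lambda>x. f (- x))"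
      proof (rule compact_support_integrable[OF _ compact_uminus_image[OF f(5)]])
        show "continuous_on UNIV (\<lambda>x. f (- x))"
          using continuous_on_compose2[OF f(1) continuous_on_uminus_UNIV[where 'a='a]] by simp
        show "f (- x) = 0" if "x \<notin> uminus ` C" for x
          using that f0[of "- x"] vim[of C] by auto
      qed
      have "emeasure haar K = (\<integral>\<^sup>+x. indicator K x \<partial>haar)"
        using compact_imp_closed[OF K(1)] by simp
      also have "\<dots> \<le> (\<integral>\<^sup>+x. f x \<partial>haar)"
        by (rule nn_integral_mono) (use f in \<open>auto simp: indicator_def\<close>)
      also have "\<dots> = ennreal (\<integral>x. f (- x) \<partial>haar)"
        using compact_support_integral_uminus[OF uni f(1,5) f0] f_int f(2)
        by (simp add: nn_integral_eq_integral)
      also have "\<dots> = (\<integral>\<^sup>+x. f (- x) \<partial>haar)"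
        using f_int' f(2) by (simp add: nn_integral_eq_integral)
      also have "\<dots> \<le> (\<integral>\<^sup>+x. indicator U x \<partial>haar)"
      proof (rule nn_integral_mono)
        fix x show "ennreal (f (- x)) \<le> indicator U x"
          using f(6)[of "- x"] f(3)[of "- x"] by (cases "x \<in> U") auto
      qed
      also have "\<dots> = emeasure haar U" using U by simp
      finally show "emeasure haar K \<le> emeasure haar U" .
    qed
  qed
  have le: "emeasure haar (uminus -` A) \<le> emeasure haar A" if A: "A \<in> sets borel" for A :: "'a set"
    unfolding emeasure_haar_outer[OF A]
  proof (rule INF_greatest, clarify)
    fix U assume U: "open U" "A \<subseteq> U"
    have "open (uminus -` U)"
      using continuous_on_uminus_UNIV[where 'a='a] U by (simp add: continuous_on_open_vimage)
    then have "emeasure haar (uminus -` A) \<le> emeasure haar (uminus -` U)"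
      using U by (intro emeasure_mono) auto
    also have "\<dots> \<le> emeasure haar U" by (rule open_le[OF U(1)])
    finally show "emeasure haar (uminus -` A) \<le> emeasure haar U" .
  qed
  fix A :: "'a set" assume A: "A \<in> sets borel"
  have "uminus -` A \<in> sets borel"
    using measurable_sets[OF borel_measurable_continuous_onI[OF continuous_on_uminus_UNIV[where 'a='a]] A] by simp
  from le[OF this] have "emeasure haar A \<le> emeasure haar (uminus -` A)"
    by (simp add: vimage_def)
  with le[OF A] show "emeasure haar (uminus -` A) = emeasure haar A" by (rule antisym)
qed (rule continuous_on_uminus_UNIV)

section \<open>The space of square integrable functions\<close>

lemma square_integrable_rep_L2: "square_integrable haar (rep_L2 h)"
  using Quotient_rep_reflp[OF Quotient_L2, of h] by (simp add: L2_rel_def)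

lemma abs_rep_L2 [simp]: "abs_L2 (rep_L2 h) = h"
  by (rule Quotient_abs_rep[OF Quotient_L2])

lemma abs_L2_eqI:
  "square_integrable haar f \<Longrightarrow> square_integrable haar g \<Longrightarrow> (AE x in haar. f x = g x) \<Longrightarrow> abs_L2 f = abs_L2 g"
  by (rule Quotient_rel_abs[OF Quotient_L2]) (simp add: L2_rel_def)

lemma rep_abs_L2_AE: "square_integrable haar f \<Longrightarrow> AE x in haar. rep_L2 (abs_L2 f) x = f x"
  using Quotient_rep_abs[OF Quotient_L2, of f] by (simp add: L2_rel_def)

lemma abs_L2_add:
  "square_integrable haar f \<Longrightarrow> square_integrable haar g \<Longrightarrow> abs_L2 (\<lambda>x. f x + g x) = abs_L2 f + abs_L2 g"
  by (simp add: plus_L2.abs_eq L2_rel_def)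

lemma abs_L2_diff:
  "square_integrable haar f \<Longrightarrow> square_integrable haar g \<Longrightarrow> abs_L2 (\<lambda>x. f x - g x) = abs_L2 f - abs_L2 g"
  by (simp add: minus_L2.abs_eq L2_rel_def)

lemma abs_L2_scaleR:
  "square_integrable haar f \<Longrightarrow> abs_L2 (\<lambda>x. complex_of_real r * f x) = r *\<^sub>R abs_L2 f"
  by (simp add: scaleR_L2_def scaleC_L2.abs_eq L2_rel_def)

lemma abs_L2_zero: "abs_L2 (\<lambda>x. 0) = 0"
  by (simp add: zero_L2.abs_eq)

lemma norm_abs_L2: "square_integrable haar f \<Longrightarrow> norm (abs_L2 f) = sqrt (\<integral>x. (cmod (f x))\<^sup>2 \<partial>haar)"
  by (simp add: norm_L2.abs_eq L2_rel_def)

lemma norm_abs_L2_power2: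
  "square_integrable haar f \<Longrightarrow> (norm (abs_L2 f))\<^sup>2 = (\<integral>x. (cmod (f x))\<^sup>2 \<partial>haar)"
  by (simp add: norm_abs_L2)

lemma inner_abs_L2:
  "square_integrable haar f \<Longrightarrow> square_integrable haar g \<Longrightarrow>
    inner (abs_L2 f) (abs_L2 g) = (\<integral>x. inner (f x) (g x) \<partial>haar)"
  by (simp add: inner_L2.abs_eq L2_rel_def)

section \<open>Completeness of L2\<close>

lemma Fatou_square_integrable:
  fixes f :: "nat \<Rightarrow> 'a \<Rightarrow> complex"
  assumes f: "\<And>n. square_integrable M (f n)" and bound: "\<And>n. (\<integral>x. (cmod (f n x))\<^sup>2 \<partial>M) \<le> B"
    and lim: "AE x in M. (\<lambda>n. f n x) \<longlonglongrightarrow> g x" and g: "g \<in> borel_measurable M"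
  shows "square_integrable M g" "(\<integral>x. (cmod (g x))\<^sup>2 \<partial>M) \<le> B"
proof -
  have [measurable]: "\<And>n. f n \<in> borel_measurable M" and f': "\<And>n. integrable M (\<lambda>x. (cmod (f n x))\<^sup>2)"
    using f by (auto simp: square_integrable_def)
  note [measurable] = g
  have "0 \<le> (\<integral>x. (cmod (f 0 x))\<^sup>2 \<partial>M)" by (rule Bochner_Integration.integral_nonneg) simp
  then have B: "0 \<le> B" using bound[of 0] by linarith
  have "(\<integral>\<^sup>+x. ennreal ((cmod (g x))\<^sup>2) \<partial>M) = (\<integral>\<^sup>+x. liminf (\<lambda>n. ennreal ((cmod (f n x))\<^sup>2)) \<partial>M)"
  proof (rule nn_integral_cong_AE, use lim in eventually_elim)
    fix x assume "(\<lambda>n. f n x) \<longlonglongrightarrow> g x"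
    then have "(\<lambda>n. ennreal ((cmod (f n x))\<^sup>2)) \<longlonglongrightarrow> ennreal ((cmod (g x))\<^sup>2)"
      by (intro tendsto_ennrealI tendsto_intros)
    then show "ennreal ((cmod (g x))\<^sup>2) = liminf (\<lambda>n. ennreal ((cmod (f n x))\<^sup>2))"
      using lim_imp_Liminf[OF trivial_limit_sequentially] by metis
  qed
  also have "\<dots> \<le> liminf (\<lambda>n. \<integral>\<^sup>+x. ennreal ((cmod (f n x))\<^sup>2) \<partial>M)"
    by (rule nn_integral_liminf) measurable
  also have "\<dots> = liminf (\<lambda>n. ennreal (\<integral>x. (cmod (f n x))\<^sup>2 \<partial>M))"
    using f' by (simp add: nn_integral_eq_integral)
  also have "\<dots> \<le> ennreal B"
    by (rule order_trans[OF Liminf_le_Limsup Limsup_bounded]) (use bound B in \<open>auto intro!: always_eventually ennreal_leI\<close>)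
  finally have le: "(\<integral>\<^sup>+x. ennreal ((cmod (g x))\<^sup>2) \<partial>M) \<le> ennreal B" .
  then have "integrable M (\<lambda>x. (cmod (g x))\<^sup>2)"
    by (intro integrableI_nonneg) (auto simp: le_less_trans)
  then show "square_integrable M g" "(\<integral>x. (cmod (g x))\<^sup>2 \<partial>M) \<le> B"
    using le B g by (simp_all add: square_integrable_def nn_integral_eq_integral)
qed

text \<open>The inequality between arithmetic and geometric means bounds
  \<open>2 * norm (d n)\<close> by \<open>2 ^ n * (norm (d n))\<^sup>2 + (1/2) ^ n\<close>. The
  weights allow pointwise convergence to be read off from integrals of squares alone, without a
  Minkowski inequality for infinite sums.\<close>

lemma summable_of_weighted_square:
  fixes d :: "nat \<Rightarrow> 'a::banach"
  assumes "summable (\<lambda>n. 2 ^ n * (norm (d n))\<^sup>2)"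
  shows "summable d"
proof (rule summable_comparison_test')
  show "summable (\<lambda>n. 2 ^ n * (norm (d n))\<^sup>2 + (1/2) ^ n)"
    using assms by (intro summable_add summable_geometric) auto
  show "norm (d n) \<le> 2 ^ n * (norm (d n))\<^sup>2 + (1/2) ^ n" for n
  proof -
    have "0 \<le> (2 ^ n * norm (d n) - 1)\<^sup>2 / 2 ^ n" by simp
    also have "\<dots> = 2 ^ n * (norm (d n))\<^sup>2 - 2 * norm (d n) + (1/2) ^ n"
      by (simp add: power2_eq_square field_simps)
    finally show ?thesis using norm_ge_zero[of "d n"] by linarith
  qed
qed

instance L2 :: (locally_compact_haar_group) banach
proof
  fix X :: "nat \<Rightarrow> 'a L2" assume X: "Cauchy X"
  have "\<exists>s. strict_mono s \<and> (\<forall>n. \<forall>m\<ge>s n. norm (X m - X (s n)) \<le> (1/2) ^ n)"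
  proof -
    have "\<exists>m. \<forall>N\<ge>m. dist (X N) (X m) < (1/2) ^ n" for n
      using X[unfolded Cauchy_altdef2] by (simp add: dist_commute)
    then obtain M where M: "\<And>n N. N \<ge> M n \<Longrightarrow> dist (X N) (X (M n)) < (1/2) ^ n" by metis
    \<comment> \<open>As \<open>s n\<close> lies beyond \<open>M (Suc n)\<close>, two errors of
      \<open>(1/2) ^ Suc n\<close> add up to \<open>(1/2) ^ n\<close>. The maximum with
      \<open>Suc k\<close> makes \<open>s\<close> strictly increasing.\<close>
    define s where "s = rec_nat (M 1) (\<lambda>n k. max (Suc k) (M (Suc (Suc n))))"
    have s: "s n \<ge> M (Suc n)" "s n < s (Suc n)" for n
      by (induction n) (auto simp: s_def)
    have "norm (X m - X (s n)) \<le> (1/2) ^ n" if "m \<ge> s n" for m n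
    proof -
      have "dist (X m) (X (s n)) \<le> dist (X m) (X (M (Suc n))) + dist (X (s n)) (X (M (Suc n)))"
        by (rule dist_triangle2)
      also have "\<dots> \<le> (1/2) ^ Suc n + (1/2) ^ Suc n"
        using M[of "Suc n" m] M[of "Suc n" "s n"] s(1)[of n] that by (intro add_mono) auto
      finally show ?thesis by (simp add: dist_norm)
    qed
    then show ?thesis
      using s(2) strict_monoI_Suc by blast
  qed
  then obtain s where s: "strict_mono s" "\<And>n m. m \<ge> s n \<Longrightarrow> norm (X m - X (s n)) \<le> (1/2) ^ n"
    by blast
  define f where "f n = rep_L2 (X (s n))" for n
  have f: "square_integrable haar (f n)" for n by (simp add: f_def square_integrable_rep_L2)
  then have [measurable]: "f n \<in> borel_measurable haar" for n by (simp add: square_integrable_def)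
  have Xf: "X (s n) = abs_L2 (f n)" for n by (simp add: f_def)
  have fd: "square_integrable haar (\<lambda>x. f m x - f n x)"
    "(\<integral>x. (cmod (f m x - f n x))\<^sup>2 \<partial>haar) = (norm (X (s m) - X (s n)))\<^sup>2" for m n
    using norm_abs_L2_power2[of "\<lambda>x. f m x - f n x"] f
    by (simp_all add: square_integrable_diff abs_L2_diff Xf)
  have fd_le: "(\<integral>x. (cmod (f m x - f n x))\<^sup>2 \<partial>haar) \<le> (1/4) ^ n" if "n \<le> m" for m n
  proof -
    have "(norm (X (s m) - X (s n)))\<^sup>2 \<le> ((1/2) ^ n)\<^sup>2"
      using s that strict_mono_less_eq[OF s(1)] by (intro power_mono) auto
    also have "\<dots> = (1/4) ^ n" by (simp add: power_mult_distrib power2_eq_square flip: power_mult_distrib)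
    finally show ?thesis by (simp add: fd)
  qed
  \<comment> \<open>The squared increments integrate to at most \<open>(1/4) ^ n\<close>, so the
    weights \<open>2 ^ n\<close> still leave a convergent geometric series.\<close>
  have "(\<integral>\<^sup>+x. (\<Sum>n. ennreal (2 ^ n * (cmod (f (Suc n) x - f n x))\<^sup>2)) \<partial>haar)
      = (\<Sum>n. \<integral>\<^sup>+x. ennreal (2 ^ n * (cmod (f (Suc n) x - f n x))\<^sup>2) \<partial>haar)"
    by (rule nn_integral_suminf) measurable
  also have "\<dots> \<le> (\<Sum>n. ennreal ((1/2) ^ n))"
  proof (rule suminf_le)
    fix n
    have "(\<integral>\<^sup>+x. ennreal (2 ^ n * (cmod (f (Suc n) x - f n x))\<^sup>2) \<partial>haar)
        = ennreal (\<integral>x. 2 ^ n * (cmod (f (Suc n) x - f n x))\<^sup>2 \<partial>haar)"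
      using fd(1)[of "Suc n" n] by (intro nn_integral_eq_integral) (auto simp: square_integrable_def)
    also have "\<dots> \<le> ennreal (2 ^ n * (1/4) ^ n)"
      using fd_le[of n "Suc n"] by (intro ennreal_leI) simp
    also have "2 ^ n * (1/4) ^ n = (1/2 :: real) ^ n"
      by (simp flip: power_mult_distrib)
    finally show "(\<integral>\<^sup>+x. ennreal (2 ^ n * (cmod (f (Suc n) x - f n x))\<^sup>2) \<partial>haar) \<le> ennreal ((1/2) ^ n)" .
  qed auto
  also have "\<dots> = ennreal (\<Sum>n. (1/2) ^ n)"
    by (rule suminf_ennreal2) (auto simp: summable_geometric)
  also have "\<dots> < \<infinity>" by simp
  finally have fin: "(\<integral>\<^sup>+x. (\<Sum>n. ennreal (2 ^ n * (cmod (f (Suc n) x - f n x))\<^sup>2)) \<partial>haar) < \<infinity>" .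
  have "AE x in haar. (\<Sum>n. ennreal (2 ^ n * (cmod (f (Suc n) x - f n x))\<^sup>2)) \<noteq> \<infinity>"
  proof (rule nn_integral_PInf_AE)
    show "(\<lambda>x. \<Sum>n. ennreal (2 ^ n * (cmod (f (Suc n) x - f n x))\<^sup>2)) \<in> borel_measurable haar"
      by measurable
  qed (use fin in simp)
  then have conv: "AE x in haar. convergent (\<lambda>n. f n x)"
  proof eventually_elim
    fix x assume "(\<Sum>n. ennreal (2 ^ n * (cmod (f (Suc n) x - f n x))\<^sup>2)) \<noteq> \<infinity>"
    then have "summable (\<lambda>n. 2 ^ n * (cmod (f (Suc n) x - f n x))\<^sup>2)"
      by (intro summable_suminf_not_top) auto
    then have "summable (\<lambda>n. f (Suc n) x - f n x)" by (rule summable_of_weighted_square)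
    then obtain l where "(\<lambda>n. f n x - f 0 x) \<longlonglongrightarrow> l"
      unfolding summable_iff_convergent sum_lessThan_telescope[of "\<lambda>n. f n x"] convergent_def by blast
    from tendsto_add[OF this tendsto_const[of "f 0 x"]] show "convergent (\<lambda>n. f n x)"
      by (auto simp: convergent_def)
  qed
  define g where "g x = lim (\<lambda>n. f n x)" for x
  have g [measurable]: "g \<in> borel_measurable haar"
    unfolding g_def by (rule borel_measurable_lim_metric) measurable
  have fg: "square_integrable haar (\<lambda>x. f m x - g x)"
    "(\<integral>x. (cmod (f m x - g x))\<^sup>2 \<partial>haar) \<le> (1/4) ^ m" for m
  proof -
    \<comment> \<open>Fatou's lemma for the differences \<open>f m - f (n + m)\<close>, as
      \<open>n\<close> grows, gives square integrability of \<open>f m - g\<close> and the rate of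
      convergence at once. Then \<open>g\<close> itself is recovered as
      \<open>f 0 - (f 0 - g)\<close>.\<close>
    have *: "AE x in haar. (\<lambda>n. f m x - f (n + m) x) \<longlonglongrightarrow> f m x - g x"
      using conv by eventually_elim
        (auto simp: g_def convergent_LIMSEQ_iff intro!: tendsto_intros LIMSEQ_ignore_initial_segment)
    have **: "(\<integral>x. (cmod (f m x - f (n + m) x))\<^sup>2 \<partial>haar) \<le> (1/4) ^ m" for n
      using fd_le[of m "n + m"] by (simp add: norm_minus_commute)
    show "square_integrable haar (\<lambda>x. f m x - g x)"
      "(\<integral>x. (cmod (f m x - g x))\<^sup>2 \<partial>haar) \<le> (1/4) ^ m"
      using Fatou_square_integrable[OF fd(1) ** *] by auto
  qed
  have "square_integrable haar (\<lambda>x. f 0 x - (f 0 x - g x))"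
    by (rule square_integrable_diff[OF f fg(1)])
  then have g': "square_integrable haar g" by simp
  have "norm (X (s m) - abs_L2 g) \<le> (1/2) ^ m" for m
  proof (rule power2_le_imp_le)
    have "(norm (X (s m) - abs_L2 g))\<^sup>2 = (\<integral>x. (cmod (f m x - g x))\<^sup>2 \<partial>haar)"
      unfolding Xf abs_L2_diff[OF f g', symmetric] by (rule norm_abs_L2_power2[OF fg(1)])
    also have "\<dots> \<le> (1/4) ^ m" by (rule fg)
    also have "\<dots> = ((1/2) ^ m)\<^sup>2" by (simp add: power2_eq_square flip: power_mult_distrib)
    finally show "(norm (X (s m) - abs_L2 g))\<^sup>2 \<le> ((1/2) ^ m)\<^sup>2" .
  qed simp
  then have "(\<lambda>m. norm ((X \<circ> s) m - abs_L2 g)) \<longlonglongrightarrow> 0"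
    by (intro tendsto_sandwich[OF _ _ tendsto_const LIMSEQ_power_zero[of "1/2 :: real"]]) auto
  then have "(X \<circ> s) \<longlonglongrightarrow> abs_L2 g" by (simp add: tendsto_norm_zero_iff LIM_zero_iff comp_def)
  then show "convergent X"
    using Cauchy_converges_subseq[OF X s(1)] by (auto simp: convergent_def)
qed

section \<open>Density of the compactly supported continuous functions in L2\<close>

lemma Cc_scale: "f \<in> Cc \<Longrightarrow> (\<lambda>x. c * f x) \<in> Cc"
  by (erule CcE) (rule CcI, auto intro!: continuous_intros)

lemma Cc_add:
  assumes "f \<in> Cc" "g \<in> Cc" shows "(\<lambda>x. f x + g x) \<in> Cc"
proof -
  obtain K where K: "continuous_on UNIV f" "compact K" "\<And>x. x \<notin> K \<Longrightarrow> f x = 0"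
    using CcE[OF assms(1)] by blast
  obtain L where L: "continuous_on UNIV g" "compact L" "\<And>x. x \<notin> L \<Longrightarrow> g x = 0"
    using CcE[OF assms(2)] by blast
  show ?thesis
    by (rule CcI[of _ "K \<union> L"]) (use K L in \<open>auto intro!: continuous_intros\<close>)
qed

lemma subspace_abs_L2_Cc: "subspace (abs_L2 ` Cc)"
proof (rule subspaceI)
  show "0 \<in> abs_L2 ` Cc"
    by (rule image_eqI[of _ _ "\<lambda>x. 0"]) (auto simp: abs_L2_zero intro!: CcI[of _ "{}"])
  fix a b :: "'a L2" and r assume "a \<in> abs_L2 ` Cc" "b \<in> abs_L2 ` Cc"
  then obtain f g where fg: "f \<in> Cc" "a = abs_L2 f" "g \<in> Cc" "b = abs_L2 g" by blast
  then show "a + b \<in> abs_L2 ` Cc"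
    by (intro image_eqI[of _ _ "\<lambda>x. f x + g x"]) (auto simp: abs_L2_add Cc_square_integrable Cc_add)
  show "r *\<^sub>R a \<in> abs_L2 ` Cc"
    using fg by (intro image_eqI[of _ _ "\<lambda>x. complex_of_real r * f x"])
      (auto simp: abs_L2_scaleR Cc_square_integrable Cc_scale)
qed

lemma square_integrable_indicator:
  assumes "A \<in> sets haar" "emeasure haar A < \<infinity>"
  shows "square_integrable haar (\<lambda>x. c * indicator A x)"
proof (rule square_integrable_scale)
  have "(\<lambda>x. (cmod (indicator A x))\<^sup>2) = indicator A"
    by (auto simp: indicator_def)
  then show "square_integrable haar (indicator A)"
    using assms by (simp add: square_integrable_def)
qed

text \<open>Inner regularity is demanded of open sets only, so the compact set \<open>K\<close> is
  taken inside an open \<open>U \<supseteq> A\<close> rather than inside \<open>A\<close>. A cutoff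
  between \<open>K\<close> and \<open>U\<close> still agrees with the indicator of \<open>A\<close>
  outside the two small sets \<open>U - A\<close> and \<open>U - K\<close>.\<close>

lemma indicator_in_closure_Cc:
  fixes A :: "'a::locally_compact_haar_group set"
  assumes A: "A \<in> sets borel" "emeasure haar A < \<infinity>"
  shows "abs_L2 (\<lambda>x. c * indicator A x) \<in> closure (abs_L2 ` Cc)"
proof (rule closure_approachable[THEN iffD2], intro allI impI)
  fix e :: real assume "e > 0"
  \<comment> \<open>Two sets of measure at most \<open>d\<close> will contribute
    \<open>(cmod c)\<^sup>2 * (d + d) \<le> e\<^sup>2 / 2\<close>; the summand 1 covers
    \<open>c = 0\<close>.\<close>
  define d where "d = e\<^sup>2 / (4 * ((cmod c)\<^sup>2 + 1))"
  have d: "d > 0" using \<open>e > 0\<close> by (simp add: d_def add_nonneg_pos)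
  have "emeasure haar A < emeasure haar A + ennreal d"
    using ennreal_add_left_cancel_less[of "emeasure haar A" 0 "ennreal d"] A(2) d by simp
  then have "(INF U\<in>{U. open U \<and> A \<subseteq> U}. emeasure haar U) < emeasure haar A + d"
    by (simp only: emeasure_haar_outer[OF A(1), symmetric])
  then obtain U where U: "open U" "A \<subseteq> U" "emeasure haar U < emeasure haar A + d"
    by (auto simp: INF_less_iff)
  have Ufin: "emeasure haar U < \<infinity>"
    using U(3) A(2) by (metis ennreal_add_less_top ennreal_less_top infinity_ennreal_def order.strict_trans)
  obtain K where K: "compact K" "K \<subseteq> U" "emeasure haar U < emeasure haar K + d"
  proof (cases "emeasure haar U = 0")
    case True
    then show ?thesis using that[of "{}"] d by simp
  next
    case False
    then have "emeasure haar U - ennreal d < emeasure haar U"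
      using Ufin d by (intro ennreal_between) (auto simp: zero_less_iff_neq_zero)
    then obtain K where K: "compact K" "K \<subseteq> U" "emeasure haar U - ennreal d < emeasure haar K"
      unfolding less_SUP_iff emeasure_haar_inner[OF U(1)] by blast
    \<comment> \<open>Extended subtraction is truncated at 0, so the case of \<open>d\<close>
      exceeding the measure of \<open>U\<close> is separate.\<close>
    have "emeasure haar U < emeasure haar K + d"
    proof (cases "ennreal d \<le> emeasure haar U")
      case True
      with K(3) show ?thesis by (simp add: minus_less_iff_ennreal)
    next
      case False
      then have "emeasure haar U < ennreal d" by simp
      also have "\<dots> \<le> emeasure haar K + d" by simp
      finally show ?thesis .
    qed
    with K show ?thesis using that by blast
  qed
  obtain \<phi> :: "'a \<Rightarrow> real" and C where \<phi>: "continuous_on UNIV \<phi>" "\<And>x. 0 \<le> \<phi> x" "\<And>x. \<phi> x \<le> 1"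
    "\<And>x. x \<in> K \<Longrightarrow> \<phi> x = 1" "compact C" "\<And>x. x \<notin> C \<inter> U \<Longrightarrow> \<phi> x = 0"
    by (rule Urysohn_cutoff[OF K(1) U(1) K(2)]) blast
  define g where "g x = c * complex_of_real (\<phi> x)" for x
  have g: "g \<in> Cc"
    unfolding g_def by (rule CcI[OF _ \<phi>(5)]) (use \<phi> in \<open>auto intro!: continuous_intros\<close>)
  have si: "square_integrable haar (\<lambda>x. c * indicator A x)"
    using A by (intro square_integrable_indicator) auto
  have sets: "U \<in> sets haar" "K \<in> sets haar" "A \<in> sets haar"
    using U(1) compact_imp_closed[OF K(1)] A by auto
  have fin: "emeasure haar K < \<infinity>" by (rule emeasure_haar_compact[OF K(1)])
  have ms: "emeasure haar (U - A) < \<infinity>" "emeasure haar (U - K) < \<infinity>"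
    using Ufin sets by (auto intro: le_less_trans[OF emeasure_mono])
  have m1: "measure haar (U - A) \<le> d"
    using U(2,3) sets A(2) Ufin d
    by (subst measure_Diff) (auto simp: emeasure_eq_ennreal_measure less_top ennreal_less_iff simp flip: ennreal_plus)
  have m2: "measure haar (U - K) \<le> d"
    using K(2,3) sets fin Ufin d
    by (subst measure_Diff) (auto simp: emeasure_eq_ennreal_measure less_top ennreal_less_iff simp flip: ennreal_plus)
  have "(norm (abs_L2 g - abs_L2 (\<lambda>x. c * indicator A x)))\<^sup>2 = (\<integral>x. (cmod (g x - c * indicator A x))\<^sup>2 \<partial>haar)"
    unfolding abs_L2_diff[OF Cc_square_integrable[OF g] si, symmetric]
    by (rule norm_abs_L2_power2[OF square_integrable_diff[OF Cc_square_integrable[OF g] si]])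
  also have "\<dots> \<le> (\<integral>x. (cmod c)\<^sup>2 * (indicator (U - A) x + indicator (U - K) x) \<partial>haar)"
  proof (rule integral_mono')
    show "integrable haar (\<lambda>x. (cmod c)\<^sup>2 * (indicator (U - A) x + indicator (U - K) x) :: real)"
      using ms sets by (intro integrable_mult_right Bochner_Integration.integrable_add) auto
    fix x
    have "(cmod (g x - c * indicator A x))\<^sup>2 = (cmod c)\<^sup>2 * (cmod (of_real (\<phi> x - indicator A x)))\<^sup>2"
      by (simp add: g_def indicator_def flip: power_mult_distrib norm_mult)
        (simp add: algebra_simps)
    also have "\<dots> = (cmod c)\<^sup>2 * (\<phi> x - indicator A x)\<^sup>2" by (simp only: norm_of_real power2_abs)
    also have "\<dots> \<le> (cmod c)\<^sup>2 * (indicator (U - A) x + indicator (U - K) x)"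
    proof (rule mult_left_mono)
      have "(\<phi> x - indicator A x)\<^sup>2 \<le> 1"
        using \<phi>(2,3)[of x] by (auto simp: indicator_def abs_square_le_1)
      moreover have "\<phi> x = 0" "x \<notin> A" if "x \<notin> U" using that \<phi>(6) U(2) by auto
      ultimately show "(\<phi> x - indicator A x)\<^sup>2 \<le> indicator (U - A) x + indicator (U - K) x"
        using \<phi>(4)[of x] by (auto simp: indicator_def split: if_splits)
    qed simp
    finally show "(cmod (g x - c * indicator A x))\<^sup>2 \<le> (cmod c)\<^sup>2 * (indicator (U - A) x + indicator (U - K) x)" .
  qed simp
  also have "\<dots> = (cmod c)\<^sup>2 * (measure haar (U - A) + measure haar (U - K))"
    using ms sets by simp
  also have "\<dots> \<le> (cmod c)\<^sup>2 * (d + d)"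
    using m1 m2 by (intro mult_left_mono add_mono) auto
  also have "\<dots> \<le> ((cmod c)\<^sup>2 + 1) * (d + d)"
    using d by (intro mult_right_mono) auto
  also have "\<dots> = e\<^sup>2 / 2"
  proof -
    have "q * (e\<^sup>2 / (4 * q) + e\<^sup>2 / (4 * q)) = e\<^sup>2 / 2" if "q \<noteq> 0" for q :: real
      using that by (simp add: field_simps)
    from this[of "(cmod c)\<^sup>2 + 1"] show ?thesis
      by (simp add: d_def add_nonneg_eq_0_iff)
  qed
  also have "\<dots> < e\<^sup>2" using \<open>e > 0\<close> by simp
  finally have "norm (abs_L2 g - abs_L2 (\<lambda>x. c * indicator A x)) < e"
    using \<open>e > 0\<close> by (auto intro: power_less_imp_less_base)
  then show "\<exists>y\<in>abs_L2 ` Cc. dist y (abs_L2 (\<lambda>x. c * indicator A x)) < e"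
    using g by (auto simp: dist_norm)
qed

lemma closure_subspace:
  fixes S :: "'a::real_normed_vector set"
  assumes "subspace S" shows "subspace (closure S)"
proof (rule subspaceI)
  show "0 \<in> closure S"
    using subspace_0[OF assms] closure_subset by blast
  fix x y and r :: real assume "x \<in> closure S" "y \<in> closure S"
  then obtain a b where ab: "\<And>n. a n \<in> S" "a \<longlonglongrightarrow> x" "\<And>n. b n \<in> S" "b \<longlonglongrightarrow> y"
    unfolding closure_sequential by blast
  show "x + y \<in> closure S"
    unfolding closure_sequential
    by (rule exI[of _ "\<lambda>n. a n + b n"]) (auto intro!: tendsto_intros ab subspace_add[OF assms])
  show "r *\<^sub>R x \<in> closure S"
    unfolding closure_sequential
    by (rule exI[of _ "\<lambda>n. r *\<^sub>R a n"]) (auto intro!: tendsto_intros ab subspace_scale[OF assms])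
qed

lemma simple_function_in_closure_Cc:
  fixes s :: "'a::locally_compact_haar_group \<Rightarrow> complex"
  assumes s: "simple_function haar s" "square_integrable haar s"
  shows "abs_L2 s \<in> closure (abs_L2 ` Cc)"
proof -
  have sub: "subspace (closure (abs_L2 ` Cc :: 'a L2 set))"
    by (rule closure_subspace[OF subspace_abs_L2_Cc])
  have fin: "finite (s ` UNIV)" using s(1) by (simp add: simple_function_def)
  let ?A = "\<lambda>c. s -` {c}"
  have A: "?A c \<in> sets haar" for c
    using measurable_sets[of s haar borel "{c}"] s(2) by (simp add: square_integrable_def)
  \<comment> \<open>Chebyshev's inequality: the integrand below equals 1 on the level set. Only the
    level set of 0 may have infinite measure, so the value 0 is kept out of the sums.\<close>
  have Afin: "emeasure haar (?A c) < \<infinity>" if "c \<noteq> 0" for c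
  proof -
    have "integrable haar (\<lambda>x. (cmod (s x))\<^sup>2 / (cmod c)\<^sup>2)"
      using s(2) by (simp add: square_integrable_def)
    then have "integrable haar (indicator (?A c) :: 'a \<Rightarrow> real)"
      by (rule Bochner_Integration.integrable_bound) (use that A in \<open>auto simp: indicator_def\<close>)
    then show ?thesis using A by (simp add: integrable_indicator_iff)
  qed
  have "abs_L2 (\<lambda>x. \<Sum>c\<in>S. c * indicator (?A c) x) \<in> closure (abs_L2 ` Cc) \<and>
      square_integrable haar (\<lambda>x. \<Sum>c\<in>S. c * indicator (?A c) x)"
    if "finite S" "0 \<notin> S" for S
    using that
  proof (induction S rule: finite_induct)
    case empty
    then show ?case
      using subspace_0[OF sub] by (simp add: abs_L2_zero square_integrable_zero)
  next
    case (insert c S)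
    then have c: "c \<noteq> 0" "0 \<notin> S" by auto
    have 1: "square_integrable haar (\<lambda>x. c * indicator (?A c) x)"
      using A Afin[OF c(1)] by (rule square_integrable_indicator)
    have 2: "abs_L2 (\<lambda>x. c * indicator (?A c) x) \<in> closure (abs_L2 ` Cc)"
      using A Afin[OF c(1)] by (intro indicator_in_closure_Cc) auto
    note 3 = insert.IH[OF c(2), THEN conjunct1] insert.IH[OF c(2), THEN conjunct2]
    show ?case
      unfolding sum.insert[OF insert.hyps] abs_L2_add[OF 1 3(2)]
      using subspace_add[OF sub 2 3(1)] square_integrable_add[OF 1 3(2)] by blast
  qed
  then have "abs_L2 (\<lambda>x. \<Sum>c\<in>s ` UNIV - {0}. c * indicator (?A c) x) \<in> closure (abs_L2 ` Cc)"
    using fin by blast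
  moreover have "(\<Sum>c\<in>s ` UNIV - {0}. c * indicator (?A c) x) = s x" for x
  proof -
    have "(\<Sum>c\<in>s ` UNIV - {0}. c * indicator (?A c) x) = (\<Sum>c\<in>s ` UNIV - {0}. if c = s x then c else 0)"
      by (intro sum.cong) (auto simp: indicator_def)
    also have "\<dots> = s x" using fin by (simp add: sum.delta)
    finally show ?thesis .
  qed
  ultimately show ?thesis by (simp only:)
qed

lemma closure_abs_L2_Cc: "closure (abs_L2 ` Cc) = (UNIV :: 'a::locally_compact_haar_group L2 set)"
proof (rule UNIV_eq_I[symmetric])
  fix h :: "'a L2"
  define f where "f = rep_L2 h"
  have f: "square_integrable haar f" and h: "h = abs_L2 f"
    by (simp_all add: f_def square_integrable_rep_L2)
  then have fm [measurable]: "f \<in> borel_measurable haar" and fi: "integrable haar (\<lambda>x. (cmod (f x))\<^sup>2)"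
    by (simp_all add: square_integrable_def)
  obtain F where F: "\<And>i. simple_function haar (F i)" "\<And>x. (\<lambda>i. F i x) \<longlonglongrightarrow> f x"
    "\<And>i x. cmod (F i x) \<le> 2 * cmod (f x)"
    using borel_measurable_implies_sequence_metric[OF fm, of 0] by auto
  have Fm [measurable]: "F i \<in> borel_measurable haar" for i
    using F(1) by (rule borel_measurable_simple_function)
  have Fs: "square_integrable haar (F i)" for i
  proof -
    have "integrable haar (\<lambda>x. 4 * (cmod (f x))\<^sup>2)" using fi by simp
    then have "integrable haar (\<lambda>x. (cmod (F i x))\<^sup>2)"
    proof (rule Bochner_Integration.integrable_bound)
      show "AE x in haar. norm ((cmod (F i x))\<^sup>2) \<le> norm (4 * (cmod (f x))\<^sup>2)"
        using power_mono[OF F(3)[of i], of _ 2] by (auto simp: power_mult_distrib)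
    qed measurable
    then show ?thesis by (simp add: square_integrable_def)
  qed
  have "(\<lambda>i. \<integral>x. (cmod (F i x - f x))\<^sup>2 \<partial>haar) \<longlonglongrightarrow> (\<integral>x. 0 \<partial>(haar :: 'a measure))"
  proof (rule integral_dominated_convergence)
    show "integrable haar (\<lambda>x. 9 * (cmod (f x))\<^sup>2)" using fi by simp
    show "AE x in haar. (\<lambda>i. (cmod (F i x - f x))\<^sup>2) \<longlonglongrightarrow> 0"
    proof (rule AE_I2)
      fix x
      have "(\<lambda>i. (cmod (F i x - f x))\<^sup>2) \<longlonglongrightarrow> (cmod (f x - f x))\<^sup>2"
        by (intro tendsto_intros F(2))
      then show "(\<lambda>i. (cmod (F i x - f x))\<^sup>2) \<longlonglongrightarrow> 0" by simp
    qed
    show "AE x in haar. norm ((cmod (F i x - f x))\<^sup>2) \<le> 9 * (cmod (f x))\<^sup>2" for i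
    proof (rule AE_I2)
      fix x
      have "cmod (F i x - f x) \<le> 3 * cmod (f x)"
        using norm_triangle_ineq4[of "F i x" "f x"] F(3)[of i x] by linarith
      from power_mono[OF this, of 2] show "norm ((cmod (F i x - f x))\<^sup>2) \<le> 9 * (cmod (f x))\<^sup>2"
        by (simp add: power_mult_distrib)
    qed
  qed measurable
  then have "(\<lambda>i. (norm (abs_L2 (F i) - h))\<^sup>2) \<longlonglongrightarrow> 0"
    using norm_abs_L2_power2[OF square_integrable_diff[OF Fs f]] by (simp add: h abs_L2_diff[OF Fs f])
  then have "(\<lambda>i. sqrt ((norm (abs_L2 (F i) - h))\<^sup>2)) \<longlonglongrightarrow> sqrt 0"
    by (rule tendsto_real_sqrt)
  then have "(\<lambda>i. abs_L2 (F i)) \<longlonglongrightarrow> h"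
    by (simp add: tendsto_norm_zero_iff LIM_zero_iff)
  moreover have "abs_L2 (F i) \<in> closure (abs_L2 ` Cc)" for i
    by (rule simple_function_in_closure_Cc[OF F(1) Fs])
  ultimately show "h \<in> closure (abs_L2 ` Cc)"
    by (metis closed_closure closed_sequentially)
qed

section \<open>Convolution\<close>

lemma Cc_continuous_compose: "f \<in> Cc \<Longrightarrow> continuous_on A g \<Longrightarrow> continuous_on A (\<lambda>x. f (g x))"
  by (rule continuous_on_compose2[of UNIV f A g]) (auto simp: Cc_def)

lemma Cc_support: "f \<in> Cc \<Longrightarrow> \<exists>K. compact K \<and> (\<forall>x. x \<notin> K \<longrightarrow> f x = 0)"
  by (metis CcE)

lemma continuous_on_convolution_integrand:
  assumes "f \<in> Cc" "h \<in> Cc"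
  shows "continuous_on UNIV (\<lambda>p. f (snd p) * h (- snd p + fst p))"
    "continuous_on UNIV (\<lambda>p. f (fst p) * h (- fst p + snd p))"
  by (intro continuous_intros Cc_continuous_compose[OF assms(1)] Cc_continuous_compose[OF assms(2)])+

lemma convolution_Cc:
  assumes f: "f \<in> Cc" and h: "h \<in> Cc"
  shows "convolution f h \<in> Cc"
proof -
  obtain K where K: "compact K" "\<And>x. x \<notin> K \<Longrightarrow> f x = 0" using Cc_support[OF f] by blast
  obtain L where L: "compact L" "\<And>x. x \<notin> L \<Longrightarrow> h x = 0" using Cc_support[OF h] by blast
  have "continuous_on UNIV (convolution f h)"
    unfolding convolution_def
    by (rule continuous_on_parametric_integral[OF continuous_on_convolution_integrand(1)[OF f h] K(1)])
      (simp add: K(2))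
  then show ?thesis
  proof (rule CcI[OF _ compact_plus_set(1)[OF K(1) L(1)]])
    fix x assume x: "x \<notin> (\<lambda>p. fst p + snd p) ` (K \<times> L)"
    have "f y * h (- y + x) = 0" for y
    proof (rule ccontr)
      assume "f y * h (- y + x) \<noteq> 0"
      then have "y \<in> K" "- y + x \<in> L" using K L by auto
      then have "y + (- y + x) \<in> (\<lambda>p. fst p + snd p) ` (K \<times> L)" by force
      with x show False by simp
    qed
    then show "convolution f h x = 0" by (simp only: convolution_def Bochner_Integration.integral_zero)
  qed
qed

lemma square_integrable_mult:
  assumes "square_integrable M f" "square_integrable M g"
  shows "integrable M (\<lambda>x. f x * g x)"
proof -
  have [measurable]: "f \<in> borel_measurable M" "g \<in> borel_measurable M"
    using assms by (auto simp: square_integrable_def)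
  have "integrable M (\<lambda>x. (cmod (f x))\<^sup>2 + (cmod (g x))\<^sup>2)"
    using assms by (auto simp: square_integrable_def)
  then show ?thesis
  proof (rule Bochner_Integration.integrable_bound)
    show "AE x in M. norm (f x * g x) \<le> norm ((cmod (f x))\<^sup>2 + (cmod (g x))\<^sup>2)"
    proof (rule AE_I2)
      fix x
      show "norm (f x * g x) \<le> norm ((cmod (f x))\<^sup>2 + (cmod (g x))\<^sup>2)"
      proof -
        have "2 * (cmod (f x) * cmod (g x)) \<le> (cmod (f x))\<^sup>2 + (cmod (g x))\<^sup>2"
          using sum_squares_bound[of "cmod (f x)" "cmod (g x)"] by (simp add: mult.assoc)
        moreover have "0 \<le> cmod (f x) * cmod (g x)" by simp
        ultimately show ?thesis unfolding norm_mult real_norm_def by linarith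
      qed
    qed
  qed measurable
qed

text \<open>The \<open>inner\<close> of L2 is only the real part of the complex inner product;
  passing to absolute values lets the real Cauchy-Schwarz inequality bound a complex
  integral.\<close>

lemma norm_integral_mult_le:
  assumes f: "square_integrable haar f" and g: "square_integrable haar g"
  shows "cmod (\<integral>x. f x * g x \<partial>haar) \<le> norm (abs_L2 f) * norm (abs_L2 g)"
proof -
  let ?n = "\<lambda>f x. complex_of_real (cmod (f x))"
  have n: "square_integrable haar (?n f)" if "square_integrable haar f" for f :: "'a \<Rightarrow> complex"
    using that by (auto simp: square_integrable_def)
  have eq: "norm (abs_L2 (?n f)) = norm (abs_L2 f)" if "square_integrable haar f" for f :: "'a \<Rightarrow> complex"
    using that n[OF that] by (simp add: norm_abs_L2)
  have "cmod (\<integral>x. f x * g x \<partial>haar) \<le> (\<integral>x. cmod (f x * g x) \<partial>haar)"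
    by (rule integral_norm_bound)
  also have "\<dots> = inner (abs_L2 (?n f)) (abs_L2 (?n g))"
    by (simp add: inner_abs_L2 n f g norm_mult inner_complex_def)
  also have "\<dots> \<le> norm (abs_L2 (?n f)) * norm (abs_L2 (?n g))"
    by (rule norm_cauchy_schwarz)
  finally show ?thesis by (simp add: eq f g)
qed

text \<open>The error is measured relative to \<open>norm h\<close>, so every approximant, even that
  for \<open>n = 0\<close>, has norm at most \<open>2 * norm h\<close>.\<close>

lemma Cc_approximation:
  fixes h :: "'a::locally_compact_haar_group L2"
  obtains g where "\<And>n. g n \<in> Cc" "\<And>n. norm (abs_L2 (g n) - h) \<le> (1/2) ^ n * norm h"
proof -
  have "\<exists>g. g \<in> Cc \<and> norm (abs_L2 g - h) \<le> (1/2) ^ n * norm h" for n :: nat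
  proof (cases "h = 0")
    case True
    then show ?thesis
      by (intro exI[of _ "\<lambda>x. 0"]) (auto simp: abs_L2_zero intro!: CcI[of _ "{}"])
  next
    case False
    then have pos: "(1/2) ^ n * norm h > 0" by simp
    have "h \<in> closure (abs_L2 ` Cc)" by (simp add: closure_abs_L2_Cc)
    from this[unfolded closure_approachable, rule_format, OF pos]
    show ?thesis by (auto simp: dist_norm intro: less_imp_le)
  qed
  then obtain g where "\<forall>n. g n \<in> Cc \<and> norm (abs_L2 (g n) - h) \<le> (1/2) ^ n * norm h"
    by metis
  then show ?thesis using that by blast
qed

lemma L2_dense_eqI:
  fixes f g :: "'a::locally_compact_haar_group L2 \<Rightarrow> 'b::real_normed_vector"
  assumes "bounded_linear f" "bounded_linear g" "\<And>h. h \<in> Cc \<Longrightarrow> f (abs_L2 h) = g (abs_L2 h)"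
  shows "f h = g h"
proof -
  have "closed {h. f h = g h}"
    using assms by (intro closed_Collect_eq linear_continuous_on)
  then have "closure (abs_L2 ` Cc) \<subseteq> {h. f h = g h}"
    using assms(3) by (intro closure_minimal) auto
  then show ?thesis by (auto simp: closure_abs_L2_Cc)
qed

section \<open>The involution on functions and on L2\<close>

definition star :: "('a::group_add \<Rightarrow> complex) \<Rightarrow> 'a \<Rightarrow> complex"
  where "star f x = cnj (f (- x))"

lemma star_star [simp]: "star (star f) = f"
  by (simp add: star_def fun_eq_iff)

lemma star_Cc:
  assumes "f \<in> Cc" shows "star f \<in> Cc"
proof -
  obtain K where K: "compact K" "\<And>x. x \<notin> K \<Longrightarrow> f x = 0" using Cc_support[OF assms] by blast
  show ?thesis
    unfolding star_def
  proof (rule CcI[OF _ compact_uminus_image[OF K(1)]])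
    show "continuous_on UNIV (\<lambda>x. cnj (f (- x)))"
      by (intro continuous_intros Cc_continuous_compose[OF assms])
    show "cnj (f (- x)) = 0" if "x \<notin> uminus ` K" for x
      using that K(2)[of "- x"] image_eqI[of x uminus "- x" K] by auto
  qed
qed

text \<open>Independence of the representative and preservation of the norm both come from the
  inversion invariance of a unimodular Haar measure; in general, an isometric involution would carry
  a power of the modular function.\<close>

definition L2_star :: "'a::locally_compact_haar_group L2 \<Rightarrow> 'a L2"
  where "L2_star h = abs_L2 (star (rep_L2 h))"

lemma inner_cnj: "inner (cnj a) (cnj b) = inner a b"
  by (simp add: inner_complex_def)

lemma inner_mult_left_cnj: "inner (a * b) c = inner b (cnj a * c)" for a b c :: complex
  by (simp add: inner_complex_def algebra_simps)

context
  assumes uni: "unimodular TYPE('a::locally_compact_haar_group)"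
begin

lemma haar_preserving_reflect: "haar_preserving (\<lambda>y::'a. - y + x)"
  using haar_preserving_comp[OF haar_preserving_right[OF uni] haar_preserving_uminus[OF uni]] .

lemma star_square_integrable:
  "square_integrable haar f \<Longrightarrow> square_integrable haar (star (f :: 'a \<Rightarrow> complex))"
  using haar_preserving_square_integrable[OF haar_preserving_uminus[OF uni], of f]
    measurable_compose[OF _ borel_measurable_continuous_onI[of cnj], of "\<lambda>x. f (- x)"]
  by (auto simp: star_def[abs_def] square_integrable_def intro: continuous_intros)

lemma L2_star_abs:
  assumes "square_integrable haar (f :: 'a \<Rightarrow> complex)"
  shows "L2_star (abs_L2 f) = abs_L2 (star f)"
  unfolding L2_star_def
proof (rule abs_L2_eqI)
  show "AE x in haar. star (rep_L2 (abs_L2 f)) x = star f x"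
    using haar_preserving_AE[OF haar_preserving_uminus[OF uni] rep_abs_L2_AE[OF assms]]
    by eventually_elim (simp add: star_def)
qed (simp_all add: star_square_integrable square_integrable_rep_L2 assms)

lemma L2_star_L2_star [simp]: "L2_star (L2_star h) = (h :: 'a L2)"
  using L2_star_abs[OF star_square_integrable[OF square_integrable_rep_L2[of h]]]
  by (simp add: L2_star_def[of h])

lemma inner_L2_star: "inner (L2_star g) (L2_star h) = inner g (h :: 'a L2)"
proof -
  let ?g = "rep_L2 g" and ?h = "rep_L2 h"
  note [simp] = square_integrable_rep_L2[of g] square_integrable_rep_L2[of h]
  have "(\<lambda>x. inner (?g x) (?h x)) \<in> borel_measurable haar"
    using square_integrable_inner[of haar ?g ?h] by simp
  from haar_preserving_integral[OF haar_preserving_uminus[OF uni] this]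
  have "inner (abs_L2 (star ?g)) (abs_L2 (star ?h)) = inner (abs_L2 ?g) (abs_L2 ?h)"
    by (simp add: inner_abs_L2 star_square_integrable star_def inner_cnj del: abs_rep_L2)
  then show ?thesis by (simp add: L2_star_def)
qed

lemma linear_L2_star: "linear (L2_star :: 'a L2 \<Rightarrow> 'a L2)"
proof (rule linearI)
  fix g h :: "'a L2" and r :: real
  note [simp] = square_integrable_rep_L2[of g] square_integrable_rep_L2[of h]
  have "L2_star (abs_L2 (rep_L2 g) + abs_L2 (rep_L2 h)) =
      abs_L2 (\<lambda>x. star (rep_L2 g) x + star (rep_L2 h) x)"
    by (simp add: L2_star_abs star_def[abs_def] square_integrable_add del: abs_rep_L2 flip: abs_L2_add)
  also have "\<dots> = L2_star g + L2_star h"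
    by (simp add: abs_L2_add star_square_integrable L2_star_def)
  finally show "L2_star (g + h) = L2_star g + L2_star h" by simp
  have "L2_star (r *\<^sub>R abs_L2 (rep_L2 g)) = abs_L2 (\<lambda>x. complex_of_real r * star (rep_L2 g) x)"
    by (simp add: L2_star_abs star_def[abs_def] square_integrable_scale del: abs_rep_L2 flip: abs_L2_scaleR)
  also have "\<dots> = r *\<^sub>R L2_star g"
    by (simp add: abs_L2_scaleR star_square_integrable L2_star_def)
  finally show "L2_star (r *\<^sub>R g) = r *\<^sub>R L2_star g" by simp
qed

lemma bounded_linear_L2_star: "bounded_linear (L2_star :: 'a L2 \<Rightarrow> 'a L2)"
proof -
  have "norm (L2_star h) = norm h" for h :: "'a L2"
    by (simp add: norm_eq_sqrt_inner inner_L2_star)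
  then show ?thesis
    using linear_L2_star by (auto simp: bounded_linear_def bounded_linear_axioms_def intro!: exI[of _ 1])
qed

section \<open>Boundedness of left convolution on L2\<close>

lemma reflect_square_integrable:
  "square_integrable haar h \<Longrightarrow> square_integrable haar (\<lambda>y::'a. h (- y + x))"
  by (rule haar_preserving_square_integrable[OF haar_preserving_reflect])

lemma convolution_integrable:
  "f \<in> Cc \<Longrightarrow> square_integrable haar h \<Longrightarrow> integrable haar (\<lambda>y::'a. f y * h (- y + x))"
  by (rule square_integrable_mult[OF Cc_square_integrable reflect_square_integrable])

text \<open>Cauchy-Schwarz against \<open>y \<mapsto> h (- y + x)\<close>, which has the L2 norm of
  \<open>h\<close> because reflections preserve the measure. Hence L2 convergence of
  \<open>h\<close> turns into uniform convergence of the convolutions.\<close>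

lemma convolution_bound:
  fixes f :: "'a \<Rightarrow> complex"
  assumes f: "f \<in> Cc" and h: "square_integrable haar h"
  shows "cmod (convolution f h x) \<le> norm (abs_L2 f) * norm (abs_L2 h)"
proof -
  have "(\<lambda>y. (cmod (h y))\<^sup>2) \<in> borel_measurable haar"
    using h by (auto simp: square_integrable_def)
  from haar_preserving_integral[OF haar_preserving_reflect this, of x]
  have "norm (abs_L2 (\<lambda>y. h (- y + x))) = norm (abs_L2 h)"
    by (simp add: norm_abs_L2 reflect_square_integrable h)
  then show ?thesis
    using norm_integral_mult_le[OF Cc_square_integrable[OF f] reflect_square_integrable[OF h, of x]]
    by (simp add: convolution_def)
qed

lemma convolution_diff:
  fixes f :: "'a \<Rightarrow> complex"
  assumes "f \<in> Cc" "square_integrable haar g" "square_integrable haar h"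
  shows "convolution f (\<lambda>x. g x - h x) x = convolution f g x - convolution f h x"
  using convolution_integrable[OF assms(1,2)] convolution_integrable[OF assms(1,3)]
  by (simp add: convolution_def right_diff_distrib)

lemma convolution_add:
  fixes f :: "'a \<Rightarrow> complex"
  assumes "f \<in> Cc" "square_integrable haar g" "square_integrable haar h"
  shows "convolution f (\<lambda>x. g x + h x) x = convolution f g x + convolution f h x"
  using convolution_integrable[OF assms(1,2)] convolution_integrable[OF assms(1,3)]
  by (simp add: convolution_def distrib_left)

lemma convolution_scale:
  "convolution f (\<lambda>x. c * h x) x = c * convolution f h (x :: 'a)"
  by (simp add: convolution_def mult.left_commute[of _ c])

lemma convolution_cong_AE:
  fixes f :: "'a \<Rightarrow> complex"
  assumes "f \<in> Cc" "square_integrable haar g" "square_integrable haar h" "AE x in haar. g x = h x"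
  shows "convolution f g = convolution f h"
proof
  fix x
  show "convolution f g x = convolution f h x"
    unfolding convolution_def
  proof (rule integral_cong_AE)
    show "AE y in haar. f y * g (- y + x) = f y * h (- y + x)"
      using haar_preserving_AE[OF haar_preserving_reflect assms(4), of x] by eventually_elim simp
  qed (use convolution_integrable[OF assms(1,2)] convolution_integrable[OF assms(1,3)] in auto)
qed

text \<open>The summand \<open>1\<close> only serves to avoid a case distinction for \<open>f = 0\<close>.\<close>

lemma convolution_Cc_norm_le:
  fixes f :: "'a \<Rightarrow> complex"
  assumes f: "f \<in> Cc" and h: "h \<in> Cc"
  shows "norm (abs_L2 (convolution f h)) \<le> ((\<integral>x. cmod (f x) \<partial>haar) + 1) * norm (abs_L2 h)"
proof -
  let ?N = "\<integral>x. cmod (f x) \<partial>haar"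
  let ?F = "\<lambda>x y. cmod (f y) * (cmod (h (- y + x)))\<^sup>2"
  obtain K where K: "compact K" "\<And>x. x \<notin> K \<Longrightarrow> f x = 0" using Cc_support[OF f] by blast
  obtain L where L: "compact L" "\<And>x. x \<notin> L \<Longrightarrow> h x = 0" using Cc_support[OF h] by blast
  let ?S = "(\<lambda>p. fst p + snd p) ` (K \<times> L)"
  have S: "compact ?S" by (rule compact_plus_set(1)[OF K(1) L(1)])
  have contF: "continuous_on UNIV (\<lambda>p. ?F (fst p) (snd p))"
    by (intro continuous_intros Cc_continuous_compose[OF f] Cc_continuous_compose[OF h])
  have F0: "?F x y = 0" if "y \<notin> K" for x y using that K by simp
  have F0': "?F x y = 0" if x: "x \<notin> ?S" for x y
  proof (rule ccontr)
    assume "?F x y \<noteq> 0"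
    then have "y \<in> K" "- y + x \<in> L" using K L by auto
    then have "y + (- y + x) \<in> ?S" by force
    with x show False by simp
  qed
  have F_int: "integrable haar (\<lambda>y. ?F x y)" for x
    using continuous_on_section(1)[OF contF] K(1) F0 by (rule compact_support_integrable)
  have FF_int: "integrable haar (\<lambda>x. \<integral>y. ?F x y \<partial>haar)"
  proof (rule compact_support_integrable[OF continuous_on_parametric_integral[OF contF K(1)] S])
    show "?F x y = 0" if "y \<notin> K" for x y using that by (rule F0)
    show "(\<integral>y. ?F x y \<partial>haar) = 0" if "x \<notin> ?S" for x
      by (simp only: F0'[OF that] Bochner_Integration.integral_zero)
  qed
  have f_int: "integrable haar (\<lambda>x. cmod (f x))" using Cc_integrable[OF f] by simp
  have N: "?N \<ge> 0" by (simp add: Bochner_Integration.integral_nonneg)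
  \<comment> \<open>Cauchy-Schwarz with weight \<open>cmod (f y)\<close>, derived from the bound of
    \<open>t * ?b\<close> by a weighted sum of \<open>?b\<^sup>2\<close> and
    \<open>t\<^sup>2\<close>. The weights are such that integration leaves at most
    \<open>t\<^sup>2 / 2\<close> on the right, which the left-hand \<open>t * t\<close>
    absorbs.\<close>
  have le: "(cmod (convolution f h x))\<^sup>2 \<le> (?N + 1) * (\<integral>y. ?F x y \<partial>haar)" for x
  proof -
    define t where "t = cmod (convolution f h x)"
    have fh_int: "integrable haar (\<lambda>y. f y * h (- y + x))"
      by (rule convolution_integrable[OF f Cc_square_integrable[OF h]])
    have "t * t \<le> t * (\<integral>y. cmod (f y * h (- y + x)) \<partial>haar)"
      unfolding t_def convolution_def by (intro mult_left_mono integral_norm_bound) auto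
    also have "\<dots> = (\<integral>y. t * cmod (f y * h (- y + x)) \<partial>haar)" by simp
    also have "\<dots> \<le> (\<integral>y. (?N + 1) / 2 * ?F x y + t\<^sup>2 / (2 * (?N + 1)) * cmod (f y) \<partial>haar)"
    proof (rule integral_mono)
      show "integrable haar (\<lambda>y. t * cmod (f y * h (- y + x)))" using fh_int by simp
      show "integrable haar (\<lambda>y. (?N + 1) / 2 * ?F x y + t\<^sup>2 / (2 * (?N + 1)) * cmod (f y))"
        using F_int f_int by (intro Bochner_Integration.integrable_add integrable_mult_right)
      fix y
      let ?b = "cmod (h (- y + x))"
      have "0 \<le> ((?N + 1) * ?b - t)\<^sup>2 / (2 * (?N + 1))" using N by simp
      also have "\<dots> = (?N + 1) / 2 * ?b\<^sup>2 + t\<^sup>2 / (2 * (?N + 1)) - t * ?b"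
        using N by (simp add: power2_eq_square field_simps add_nonneg_eq_0_iff)
      finally have "cmod (f y) * (t * ?b) \<le> cmod (f y) * ((?N + 1) / 2 * ?b\<^sup>2 + t\<^sup>2 / (2 * (?N + 1)))"
        by (intro mult_left_mono) auto
      then show "t * cmod (f y * h (- y + x)) \<le> (?N + 1) / 2 * ?F x y + t\<^sup>2 / (2 * (?N + 1)) * cmod (f y)"
        by (simp add: norm_mult algebra_simps)
    qed
    also have "\<dots> = (?N + 1) / 2 * (\<integral>y. ?F x y \<partial>haar) + t\<^sup>2 / (2 * (?N + 1)) * ?N"
      using F_int f_int by simp
    also have "t\<^sup>2 / (2 * (?N + 1)) * ?N \<le> t\<^sup>2 / 2"
    proof -
      have "t\<^sup>2 / (2 * (?N + 1)) * ?N \<le> t\<^sup>2 / (2 * (?N + 1)) * (?N + 1)"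
        using N by (intro mult_left_mono) auto
      also have "\<dots> = t\<^sup>2 / 2"
        using N by (simp add: field_simps add_nonneg_eq_0_iff)
      finally show ?thesis .
    qed
    finally show ?thesis
      by (simp add: t_def power2_eq_square)
  qed
  have c: "convolution f h \<in> Cc" by (rule convolution_Cc[OF f h])
  have si: "square_integrable haar (convolution f h)" by (rule Cc_square_integrable[OF c])
  have h2: "(\<lambda>x. (cmod (h x))\<^sup>2) \<in> borel_measurable haar"
    using Cc_measurable[OF h] by simp
  have "(norm (abs_L2 (convolution f h)))\<^sup>2 = (\<integral>x. (cmod (convolution f h x))\<^sup>2 \<partial>haar)"
    by (rule norm_abs_L2_power2[OF si])
  also have "\<dots> \<le> (\<integral>x. (?N + 1) * (\<integral>y. ?F x y \<partial>haar) \<partial>haar)"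
    using si FF_int le by (intro integral_mono integrable_mult_right) (auto simp: square_integrable_def)
  also have "\<dots> = (?N + 1) * (\<integral>x. \<integral>y. ?F x y \<partial>haar \<partial>haar)" by simp
  \<comment> \<open>With \<open>x\<close> as the inner variable, left invariance removes the shift
    by \<open>y\<close> and the double integral factors.\<close>
  also have "(\<integral>x. \<integral>y. ?F x y \<partial>haar \<partial>haar) = (\<integral>y. \<integral>x. ?F x y \<partial>haar \<partial>haar)"
    by (rule haar_Fubini[OF contF S K(1) F0' F0])
  also have "\<dots> = (\<integral>y. cmod (f y) * (\<integral>x. (cmod (h x))\<^sup>2 \<partial>haar) \<partial>haar)"
    using haar_preserving_integral[OF haar_preserving_left h2] by simp
  also have "\<dots> = ?N * (norm (abs_L2 h))\<^sup>2"
    by (simp add: norm_abs_L2_power2[OF Cc_square_integrable[OF h]])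
  also have "(?N + 1) * \<dots> \<le> (?N + 1) * ((?N + 1) * (norm (abs_L2 h))\<^sup>2)"
    using N by (intro mult_left_mono mult_right_mono) auto
  also have "\<dots> = ((?N + 1) * norm (abs_L2 h))\<^sup>2"
    by (simp add: power2_eq_square algebra_simps)
  finally show ?thesis
    by (rule power2_le_imp_le) (use N in simp)
qed

text \<open>Approximating \<open>h\<close> from \<open>Cc\<close> gives pointwise convergence of the
  convolutions by \<open>convolution_bound\<close>, and Fatou's lemma keeps the norm bound. The
  factor 2 reflects approximants of norm up to twice that of \<open>h\<close>.\<close>

lemma convolution_square_integrable_norm_le:
  fixes f :: "'a \<Rightarrow> complex"
  assumes f: "f \<in> Cc" and h: "square_integrable haar h"
  shows "square_integrable haar (convolution f h)"
    "norm (abs_L2 (convolution f h)) \<le> 2 * ((\<integral>x. cmod (f x) \<partial>haar) + 1) * norm (abs_L2 h)"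
proof -
  let ?N = "(\<integral>x. cmod (f x) \<partial>haar) + 1"
  have N: "?N \<ge> 0" by (simp add: Bochner_Integration.integral_nonneg)
  obtain g where g: "\<And>n. g n \<in> Cc" "\<And>n. norm (abs_L2 (g n) - abs_L2 h) \<le> (1/2) ^ n * norm (abs_L2 h)"
    using Cc_approximation by blast
  have lim: "(\<lambda>n. convolution f (g n) x) \<longlonglongrightarrow> convolution f h x" for x
  proof (rule LIM_zero_cancel, rule Lim_null_comparison)
    have "(\<lambda>n. norm (abs_L2 f) * ((1/2) ^ n * norm (abs_L2 h))) \<longlonglongrightarrow> norm (abs_L2 f) * (0 * norm (abs_L2 h))"
      by (intro tendsto_intros LIMSEQ_power_zero) simp
    then show "(\<lambda>n. norm (abs_L2 f) * ((1/2) ^ n * norm (abs_L2 h))) \<longlonglongrightarrow> 0" by simp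
    have "norm (convolution f (g n) x - convolution f h x)
        \<le> norm (abs_L2 f) * ((1/2) ^ n * norm (abs_L2 h))" for n
    proof -
      note gn = Cc_square_integrable[OF g(1)[of n]]
      have "norm (convolution f (g n) x - convolution f h x)
          \<le> norm (abs_L2 f) * norm (abs_L2 (g n) - abs_L2 h)"
        unfolding convolution_diff[OF f gn h, symmetric] abs_L2_diff[OF gn h, symmetric]
        by (rule convolution_bound[OF f square_integrable_diff[OF gn h]])
      also have "\<dots> \<le> norm (abs_L2 f) * ((1/2) ^ n * norm (abs_L2 h))"
        by (intro mult_left_mono g(2)) auto
      finally show ?thesis .
    qed
    then show "\<forall>\<^sub>F n in sequentially. norm (convolution f (g n) x - convolution f h x)
        \<le> norm (abs_L2 f) * ((1/2) ^ n * norm (abs_L2 h))" by simp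
  qed
  have meas: "convolution f h \<in> borel_measurable haar"
    by (rule borel_measurable_LIMSEQ_metric[where f = "\<lambda>n. convolution f (g n)"])
      (simp_all add: lim Cc_measurable convolution_Cc f g(1))
  have bound: "(\<integral>x. (cmod (convolution f (g n) x))\<^sup>2 \<partial>haar) \<le> (2 * ?N * norm (abs_L2 h))\<^sup>2" for n
  proof -
    note c = Cc_square_integrable[OF convolution_Cc[OF f g(1)[of n]]]
    have "norm (abs_L2 (g n)) \<le> norm (abs_L2 h) + norm (abs_L2 (g n) - abs_L2 h)"
      by (rule norm_triangle_sub)
    also have "norm (abs_L2 (g n) - abs_L2 h) \<le> 1 * norm (abs_L2 h)"
      by (rule order_trans[OF g(2) mult_right_mono]) (simp_all add: power_le_one)
    finally have "norm (abs_L2 (g n)) \<le> 2 * norm (abs_L2 h)" by simp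
    then have "?N * norm (abs_L2 (g n)) \<le> ?N * (2 * norm (abs_L2 h))"
      using N by (rule mult_left_mono)
    with convolution_Cc_norm_le[OF f g(1)[of n]]
    have "norm (abs_L2 (convolution f (g n))) \<le> ?N * (2 * norm (abs_L2 h))" by (rule order_trans)
    also have "\<dots> = 2 * ?N * norm (abs_L2 h)" by (simp only: mult_ac)
    finally have "norm (abs_L2 (convolution f (g n))) \<le> 2 * ?N * norm (abs_L2 h)" .
    then show ?thesis
      unfolding norm_abs_L2_power2[OF c, symmetric] by (rule power_mono) simp
  qed
  have lim_AE: "AE x in haar. (\<lambda>n. convolution f (g n) x) \<longlonglongrightarrow> convolution f h x"
    using lim by simp
  note F = Fatou_square_integrable[where f = "\<lambda>n. convolution f (g n)",
      OF Cc_square_integrable[OF convolution_Cc[OF f g(1)]] bound lim_AE meas]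
  show *: "square_integrable haar (convolution f h)" by (rule F(1))
  have "(norm (abs_L2 (convolution f h)))\<^sup>2 \<le> (2 * ?N * norm (abs_L2 h))\<^sup>2"
    unfolding norm_abs_L2_power2[OF *] by (rule F(2))
  then show "norm (abs_L2 (convolution f h)) \<le> 2 * ?N * norm (abs_L2 h)"
    by (rule power2_le_imp_le) (use N in simp)
qed

text \<open>This discharges the side condition of \<open>Blinfun\<close>. Since
  \<open>rep_L2\<close> is not linear, additivity and homogeneity pass through the independence of
  the convolution from the representative.\<close>

lemma lambda2_apply:
  fixes f :: "'a \<Rightarrow> complex"
  assumes f: "f \<in> Cc"
  shows "blinfun_apply (lambda2 f) h = abs_L2 (convolution f (rep_L2 h))"
proof -
  note si = square_integrable_rep_L2
  note c = convolution_square_integrable_norm_le[OF f]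
  have eq: "abs_L2 (convolution f (rep_L2 (abs_L2 u))) = abs_L2 (convolution f u)"
    if "square_integrable haar u" for u :: "'a \<Rightarrow> complex"
    using convolution_cong_AE[OF f si that rep_abs_L2_AE[OF that]] by simp
  have "bounded_linear (\<lambda>h. abs_L2 (convolution f (rep_L2 h)))"
  proof (rule bounded_linear_intro)
    fix g h :: "'a L2" and r :: real
    have "abs_L2 (convolution f (rep_L2 (g + h))) = abs_L2 (convolution f (rep_L2 (abs_L2 (\<lambda>x. rep_L2 g x + rep_L2 h x))))"
      by (simp add: abs_L2_add[OF si si])
    also have "\<dots> = abs_L2 (\<lambda>x. convolution f (rep_L2 g) x + convolution f (rep_L2 h) x)"
      by (simp add: eq square_integrable_add si convolution_add[OF f si si, abs_def])
    finally show "abs_L2 (convolution f (rep_L2 (g + h))) =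
        abs_L2 (convolution f (rep_L2 g)) + abs_L2 (convolution f (rep_L2 h))"
      by (simp add: abs_L2_add[OF c(1)[OF si] c(1)[OF si]])
    have "abs_L2 (convolution f (rep_L2 (r *\<^sub>R g))) = abs_L2 (convolution f (rep_L2 (abs_L2 (\<lambda>x. complex_of_real r * rep_L2 g x))))"
      by (simp add: abs_L2_scaleR[OF si])
    also have "\<dots> = abs_L2 (\<lambda>x. complex_of_real r * convolution f (rep_L2 g) x)"
      by (simp add: eq square_integrable_scale si convolution_scale[abs_def])
    finally show "abs_L2 (convolution f (rep_L2 (r *\<^sub>R g))) = r *\<^sub>R abs_L2 (convolution f (rep_L2 g))"
      by (simp add: abs_L2_scaleR[OF c(1)[OF si]])
    show "norm (abs_L2 (convolution f (rep_L2 g))) \<le> norm g * (2 * ((\<integral>x. cmod (f x) \<partial>haar) + 1))"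
      using c(2)[OF si[of g]] by (simp add: mult.commute)
  qed
  then show ?thesis by (simp add: lambda2_def bounded_linear_Blinfun_apply)
qed

lemma lambda2_abs_L2:
  fixes f :: "'a \<Rightarrow> complex"
  assumes "f \<in> Cc" "square_integrable haar h"
  shows "blinfun_apply (lambda2 f) (abs_L2 h) = abs_L2 (convolution f h)"
  using convolution_cong_AE[OF assms(1) square_integrable_rep_L2 assms(2) rep_abs_L2_AE[OF assms(2)]]
  by (simp add: lambda2_apply[OF assms(1)])

section \<open>Involution, associativity and adjoint for convolution\<close>

lemma convolution_star:
  fixes f :: "'a \<Rightarrow> complex"
  assumes "f \<in> Cc" "h \<in> Cc"
  shows "star (convolution (star h) (star f)) = convolution f h"
proof
  fix x
  have "(\<lambda>y. f y * h (- y + x)) \<in> borel_measurable haar"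
    using convolution_integrable[OF assms(1) Cc_square_integrable[OF assms(2)]] by auto
  from haar_preserving_integral[OF haar_preserving_left[of x] this]
  have "convolution f h x = (\<integral>y. f (x + y) * h (- y) \<partial>haar)"
    by (simp add: convolution_def minus_add add.assoc)
  also have "\<dots> = star (convolution (star h) (star f)) x"
    using Bochner_Integration.integral_cnj[of haar "\<lambda>y. h (- y) * f (x + y)"]
    by (simp add: star_def convolution_def minus_add mult.commute)
  finally show "star (convolution (star h) (star f)) x = convolution f h x" by simp
qed

lemma convolution_assoc:
  fixes f :: "'a \<Rightarrow> complex"
  assumes f: "f \<in> Cc" and h: "h \<in> Cc" and v: "v \<in> Cc"
  shows "convolution f (convolution h v) = convolution (convolution f h) v"
proof
  fix x
  let ?F = "\<lambda>y z. f y * h (- y + z) * v (- z + x)"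
  obtain K where K: "compact K" "\<And>x. x \<notin> K \<Longrightarrow> f x = 0" using Cc_support[OF f] by blast
  obtain L where L: "compact L" "\<And>x. x \<notin> L \<Longrightarrow> h x = 0" using Cc_support[OF h] by blast
  let ?S = "(\<lambda>p. fst p + snd p) ` (K \<times> L)"
  have S: "compact ?S" by (rule compact_plus_set(1)[OF K(1) L(1)])
  have "convolution f (convolution h v) x = (\<integral>y. f y * (\<integral>z. h (- y + z) * v (- z + x) \<partial>haar) \<partial>haar)"
    unfolding convolution_def
  proof (rule Bochner_Integration.integral_cong[OF refl])
    fix y
    have "(\<lambda>z. h z * v (- z + (- y + x))) \<in> borel_measurable haar"
      using convolution_integrable[OF h Cc_square_integrable[OF v]] by auto
    from haar_preserving_integral[OF haar_preserving_left[of "- y"] this]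
    show "f y * (\<integral>z. h z * v (- z + (- y + x)) \<partial>haar) = f y * (\<integral>z. h (- y + z) * v (- z + x) \<partial>haar)"
      by (simp add: minus_add add.assoc)
  qed
  also have "\<dots> = (\<integral>y. \<integral>z. ?F y z \<partial>haar \<partial>haar)"
    by (simp add: mult.assoc)
  also have "\<dots> = (\<integral>z. \<integral>y. ?F y z \<partial>haar \<partial>haar)"
  proof (rule haar_Fubini[OF _ K(1) S])
    show "continuous_on UNIV (\<lambda>p. ?F (fst p) (snd p))"
      by (intro continuous_intros Cc_continuous_compose[OF f] Cc_continuous_compose[OF h] Cc_continuous_compose[OF v])
    show "?F y z = 0" if "y \<notin> K" for y z using that K by simp
    show "?F y z = 0" if "z \<notin> ?S" for y z
    proof (rule ccontr)
      assume "?F y z \<noteq> 0"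
      then have "y \<in> K" "- y + z \<in> L" using K L by auto
      then have "y + (- y + z) \<in> ?S" by force
      with that show False by simp
    qed
  qed
  also have "\<dots> = convolution (convolution f h) v x"
    by (simp add: convolution_def)
  finally show "convolution f (convolution h v) x = convolution (convolution f h) v x" .
qed

text \<open>With \<open>y\<close> outside, left translation moves the shift from \<open>h\<close> to
  \<open>k\<close>; with \<open>y\<close> inside again, inversion turns \<open>k (y + x)\<close>
  into \<open>k (- y + x)\<close>, while the factor \<open>f\<close> passes to the other side of
  \<open>inner\<close> as its conjugate.\<close>

lemma convolution_adjoint:
  fixes f :: "'a \<Rightarrow> complex"
  assumes f: "f \<in> Cc" and h: "h \<in> Cc" and k: "k \<in> Cc"
  shows "(\<integral>x. inner (convolution f h x) (k x) \<partial>haar) = (\<integral>x. inner (h x) (convolution (star f) k x) \<partial>haar)"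
proof -
  obtain K where K: "compact K" "\<And>x. x \<notin> K \<Longrightarrow> f x = 0" using Cc_support[OF f] by blast
  obtain L where L: "compact L" "\<And>x. x \<notin> L \<Longrightarrow> k x = 0" using Cc_support[OF k] by blast
  obtain M where M: "compact M" "\<And>x. x \<notin> M \<Longrightarrow> h x = 0" using Cc_support[OF h] by blast
  note int = convolution_integrable[OF f Cc_square_integrable[OF h]]
  have sf: "star f \<in> Cc" by (rule star_Cc[OF f])
  have "(\<integral>x. inner (convolution f h x) (k x) \<partial>haar)
      = (\<integral>x. \<integral>y. inner (f y * h (- y + x)) (k x) \<partial>haar \<partial>haar)"
    unfolding convolution_def using int by (simp add: integral_inner_left)
  also have "\<dots> = (\<integral>y. \<integral>x. inner (f y * h (- y + x)) (k x) \<partial>haar \<partial>haar)"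
  proof (rule haar_Fubini[OF _ L(1) K(1)])
    show "continuous_on UNIV (\<lambda>p. inner (f (snd p) * h (- snd p + fst p)) (k (fst p)))"
      by (intro continuous_intros Cc_continuous_compose[OF f] Cc_continuous_compose[OF h] Cc_continuous_compose[OF k])
  qed (simp_all add: K L)
  also have "\<dots> = (\<integral>y. \<integral>x. inner (f y * h x) (k (y + x)) \<partial>haar \<partial>haar)"
  proof (rule Bochner_Integration.integral_cong[OF refl])
    fix y
    have "continuous_on UNIV (\<lambda>x. inner (f y * h (- y + x)) (k x))"
      by (intro continuous_intros Cc_continuous_compose[OF f] Cc_continuous_compose[OF h] Cc_continuous_compose[OF k])
    from borel_measurable_continuous_onI[OF this] have "(\<lambda>x. inner (f y * h (- y + x)) (k x)) \<in> borel_measurable haar"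
      by simp
    from haar_preserving_integral[OF haar_preserving_left[of y] this]
    show "(\<integral>x. inner (f y * h (- y + x)) (k x) \<partial>haar) = (\<integral>x. inner (f y * h x) (k (y + x)) \<partial>haar)"
      by simp
  qed
  also have "\<dots> = (\<integral>x. \<integral>y. inner (f y * h x) (k (y + x)) \<partial>haar \<partial>haar)"
  proof (rule haar_Fubini[OF _ K(1) M(1)])
    show "continuous_on UNIV (\<lambda>p. inner (f (fst p) * h (snd p)) (k (fst p + snd p)))"
      by (intro continuous_intros Cc_continuous_compose[OF f] Cc_continuous_compose[OF h] Cc_continuous_compose[OF k])
  qed (simp_all add: K M)
  also have "\<dots> = (\<integral>x. inner (h x) (convolution (star f) k x) \<partial>haar)"
  proof (rule Bochner_Integration.integral_cong[OF refl])
    fix x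
    have "continuous_on UNIV (\<lambda>y. inner (f y * h x) (k (y + x)))"
      by (intro continuous_intros Cc_continuous_compose[OF f] Cc_continuous_compose[OF h] Cc_continuous_compose[OF k])
    from borel_measurable_continuous_onI[OF this] have "(\<lambda>y. inner (f y * h x) (k (y + x))) \<in> borel_measurable haar"
      by simp
    from haar_preserving_integral[OF haar_preserving_uminus[OF uni] this]
    have "(\<integral>y. inner (f y * h x) (k (y + x)) \<partial>haar) = (\<integral>y. inner (h x) (star f y * k (- y + x)) \<partial>haar)"
      by (simp add: inner_mult_left_cnj star_def)
    then show "(\<integral>y. inner (f y * h x) (k (y + x)) \<partial>haar) = inner (h x) (convolution (star f) k x)"
      using convolution_integrable[OF sf Cc_square_integrable[OF k]]
      by (simp add: convolution_def integral_inner_right)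
  qed
  finally show ?thesis .
qed

end

section \<open>Operators on real Hilbert spaces\<close>

text \<open>The contraction proof of the Lax-Milgram theorem: the solutions of
  \<open>S h = v\<close> are the fixed points of
  \<open>h \<mapsto> h - t *\<^sub>R (S h - v)\<close>.\<close>

lemma coercive_bij:
  fixes S :: "'h::{real_inner, banach} \<Rightarrow> 'h"
  assumes S: "bounded_linear S" and c: "c > 0" and coercive: "\<And>h. c * (norm h)\<^sup>2 \<le> inner (S h) h"
  shows "bij S"
proof (rule bijI)
  interpret S: bounded_linear S by (rule S)
  show "inj S"
  proof (subst linear_injective_0[OF S.linear_axioms], intro allI impI)
    fix h assume "S h = 0"
    with coercive[of h] c have "(norm h)\<^sup>2 \<le> 0" by (simp add: mult_le_0_iff)
    then show "h = 0" by simp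
  qed
  obtain M0 where M0: "\<And>h. norm (S h) \<le> norm h * M0" "M0 > 0"
    using S.pos_bounded by blast
  \<comment> \<open>Adding \<open>c\<close> to the bound ensures \<open>c < M\<close>, so the square
    root defining \<open>q\<close> has a positive argument. The step \<open>t\<close> is the
    minimiser of \<open>1 - 2 * t * c + t\<^sup>2 * M\<^sup>2\<close>.\<close>
  define M where "M = M0 + c"
  have M: "M > 0" "c < M" using M0(2) c by (auto simp: M_def)
  have SM: "norm (S h) \<le> M * norm h" for h
    using M0(1)[of h] c by (simp add: M_def algebra_simps add_increasing2)
  define t where "t = c / M\<^sup>2"
  define q where "q = sqrt (1 - c\<^sup>2 / M\<^sup>2)"
  have "c\<^sup>2 < M\<^sup>2" using M c by (intro power_strict_mono) auto
  then have q: "0 \<le> q" "q < 1" "q\<^sup>2 = 1 - c\<^sup>2 / M\<^sup>2" using M c by (auto simp: q_def)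
  have contraction: "norm (d - t *\<^sub>R S d) \<le> q * norm d" for d
  proof (rule power2_le_imp_le)
    have "(norm (d - t *\<^sub>R S d))\<^sup>2 = (norm d)\<^sup>2 - 2 * t * inner (S d) d + t\<^sup>2 * (norm (S d))\<^sup>2"
      by (simp only: power2_norm_eq_inner)
        (simp add: inner_diff_left inner_diff_right inner_commute power2_eq_square algebra_simps)
    also have "\<dots> \<le> (norm d)\<^sup>2 - 2 * t * (c * (norm d)\<^sup>2) + t\<^sup>2 * (M * norm d)\<^sup>2"
      using coercive[of d] power_mono[OF SM[of d], of 2] c M
      by (intro add_mono diff_mono mult_left_mono) (auto simp: t_def)
    also have "\<dots> = (1 - c\<^sup>2 / M\<^sup>2) * (norm d)\<^sup>2"
      using M by (simp add: t_def power2_eq_square field_simps)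
    also have "\<dots> = (q * norm d)\<^sup>2"
      by (simp add: q(3) power_mult_distrib)
    finally show "(norm (d - t *\<^sub>R S d))\<^sup>2 \<le> (q * norm d)\<^sup>2" .
  qed (use q in simp)
  show "surj S"
  proof (rule surjI[of _ "\<lambda>v. THE h. h - t *\<^sub>R (S h - v) = h"])
    fix v
    have "\<forall>h k. dist (h - t *\<^sub>R (S h - v)) (k - t *\<^sub>R (S k - v)) \<le> q * dist h k"
    proof (intro allI)
      fix h k
      have "(h - t *\<^sub>R (S h - v)) - (k - t *\<^sub>R (S k - v)) = (h - k) - t *\<^sub>R S (h - k)"
        by (simp add: S.diff algebra_simps)
      then show "dist (h - t *\<^sub>R (S h - v)) (k - t *\<^sub>R (S k - v)) \<le> q * dist h k"
        using contraction[of "h - k"] by (simp only: dist_norm)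
    qed
    from theI'[OF banach_fix_type[OF q(1,2) this]]
    show "S (THE h. h - t *\<^sub>R (S h - v) = h) = v"
      using c M by (simp add: t_def)
  qed
qed

text \<open>In the application \<open>a\<close> is left convolution by \<open>f\<close>, \<open>J f = f\<^sup>*\<close>, and \<open>r\<close>, \<open>r'\<close> are the right
  convolutions by \<open>f\<close> and \<open>f\<^sup>*\<close>.  With \<open>x = 1 - a\<close> and \<open>T = (xx\<^sup>*)\<^sup>-\<^sup>1\<close>, the projection onto the kernel
  of \<open>x\<close> is \<open>p = 1 - x\<^sup>*Tx\<close>.  Since \<open>p = pa\<^sup>*\<close>, it vanishes as soon as \<open>p J f = 0\<close>.  Now
  \<open>\<parallel>p J f\<parallel>\<^sup>2 = \<langle>T g, f - J f\<rangle>\<close>, where \<open>1 - xx\<^sup>*\<close> is left convolution by \<open>g = f + J f - a J f\<close>; then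
  \<open>T - 1\<close> is self-adjoint and left convolution by \<open>T g\<close>, which is therefore fixed by \<open>J\<close>.\<close>

lemma lower_bound_of_adjoint_lower_bound:
  fixes a a' J :: "'h::{real_inner, banach} \<Rightarrow> 'h" and f :: 'h and D :: "'h set"
  defines "r \<equiv> \<lambda>h. J (a' (J h))" and "r' \<equiv> \<lambda>h. J (a (J h))"
  assumes a: "bounded_linear a" "bounded_linear a'" and adj: "\<And>u v. inner (a u) v = inner u (a' v)"
    and J: "bounded_linear J" "\<And>u. J (J u) = u" "\<And>u v. inner (J u) (J v) = inner u v"
    and comm: "\<And>h. a (r h) = r (a h)" "\<And>h. a (r' h) = r' (a h)"
      "\<And>h. a' (r h) = r (a' h)" "\<And>h. a' (r' h) = r' (a' h)"
    and symbol: "a f = r f" "a (J f) = r' f" "a' f = r (J f)" "a' (J f) = r' (J f)"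
    and D: "closure D = UNIV"
      "\<And>h. h \<in> D \<Longrightarrow> \<exists>R. linear R \<and> (\<forall>u. a (R u) = R (a u)) \<and> (\<forall>u. a' (R u) = R (a' u)) \<and> a' h = R (J f)"
    and c: "c > 0" "\<And>h. c * norm h \<le> norm (h - a' h)"
  shows "c * norm h \<le> norm (h - a h)"
proof -
  interpret a: bounded_linear a by (rule a)
  interpret a': bounded_linear a' by (rule a)
  interpret J: bounded_linear J by (rule J)
  define x x' S where "x h = h - a h" and "x' h = h - a' h" and "S h = x (x' h)" for h
  have xbl: "bounded_linear x" "bounded_linear x'"
    unfolding x_def[abs_def] x'_def[abs_def]
    by (intro bounded_linear_sub bounded_linear_ident a)+
  then have Sbl: "bounded_linear S"
    unfolding S_def[abs_def] by (rule bounded_linear_compose)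
  interpret x: bounded_linear x by (rule xbl)
  interpret x': bounded_linear x' by (rule xbl)
  interpret S: bounded_linear S by (rule Sbl)
  have xadj: "inner (x u) v = inner u (x' v)" for u v
    by (simp add: x_def x'_def inner_diff_left inner_diff_right adj)
  have xadj': "inner (x' u) v = inner u (x v)" for u v
    using xadj[of v u] by (simp add: inner_commute)
  have Ssym: "inner (S u) v = inner u (S v)" for u v
    by (simp add: S_def xadj xadj')
  have Scoer: "c\<^sup>2 * (norm h)\<^sup>2 \<le> inner (S h) h" for h
  proof -
    have "c\<^sup>2 * (norm h)\<^sup>2 = (c * norm h)\<^sup>2" by (simp add: power_mult_distrib)
    also have "\<dots> \<le> (norm (x' h))\<^sup>2"
      using c(2)[of h] c(1) by (intro power_mono) (auto simp: x'_def)
    also have "\<dots> = inner (S h) h" by (simp add: S_def xadj power2_norm_eq_inner)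
    finally show ?thesis .
  qed
  have "bij S"
    using Sbl _ Scoer by (rule coercive_bij) (use c in simp)
  define T where "T = inv S"
  have ST: "S (T v) = v" and TS: "T (S v) = v" for v
    using \<open>bij S\<close> by (simp_all add: T_def bij_is_surj surj_f_inv_f bij_is_inj)
  have Tlin: "T (u + v) = T u + T v" "T (s *\<^sub>R u) = s *\<^sub>R T u" for u v s
    using TS[of "T u + T v"] TS[of "s *\<^sub>R T u"] by (simp_all add: S.add S.scaleR ST)
  have Tnorm: "c\<^sup>2 * norm (T v) \<le> norm v" for v
  proof -
    have "(c\<^sup>2 * norm (T v)) * norm (T v) \<le> inner v (T v)"
      using Scoer[of "T v"] by (simp add: ST power2_eq_square mult.assoc)
    also have "\<dots> \<le> norm v * norm (T v)" by (rule norm_cauchy_schwarz)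
    finally show ?thesis
      by (cases "norm (T v) = 0") auto
  qed
  have Tbl: "bounded_linear T"
  proof (rule bounded_linear_intro[OF Tlin])
    show "norm (T v) \<le> norm v * (1 / c\<^sup>2)" for v
      using Tnorm[of v] c(1) by (simp add: field_simps)
  qed
  interpret T: bounded_linear T by (rule Tbl)
  have Tsym: "inner (T u) v = inner u (T v)" for u v
    using Ssym[of "T u" "T v"] by (simp add: ST)
  \<comment> \<open>An inverse inherits commutation; this is used for \<open>U\<close>, for
    \<open>r\<close> and for the operators \<open>R\<close> attached to \<open>D\<close>.\<close>
  have Tcomm: "R (T h) = T (R h)" if "\<And>h. R (S h) = S (R h)" for R h
    using TS[of "R (T h)"] by (simp add: that[symmetric] ST)
  have Scomm: "R (S h) = S (R h)" if "linear R" "\<And>u. a (R u) = R (a u)" "\<And>u. a' (R u) = R (a' u)" for R h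
    by (simp add: S_def x_def x'_def linear_diff[OF that(1)] a.diff a'.diff that(2,3))
  have rlin: "linear r" "linear r'"
    unfolding r_def r'_def
    by (rule bounded_linear.linear, rule bounded_linear_compose[OF J(1)],
        rule bounded_linear_compose[OF _ J(1)], rule a)+
  note r_simps = linear_diff[OF rlin(1)] linear_add[OF rlin(1)] linear_diff[OF rlin(2)] linear_add[OF rlin(2)]
  have Sr: "r (S h) = S (r h)" "r' (S h) = S (r' h)" for h
    using Scomm[OF rlin(1) comm(1,3)] Scomm[OF rlin(2) comm(2,4)] by auto
  have Sdef: "S h = h - (a h + a' h - a (a' h))" for h
    by (simp add: S_def x_def x'_def a.diff algebra_simps)
  \<comment> \<open>In the application \<open>S h = h - g * h\<close>, with the \<open>g\<close>
    introduced below. As \<open>J\<close> reverses products and fixes \<open>g\<close>, the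
    conjugate \<open>U\<close> is \<open>h \<mapsto> h - h * g\<close>. The two agree on
    \<open>g\<close>, and since \<open>T\<close> commutes with \<open>U\<close> this yields
    \<open>U (T g) = g\<close>, from which \<open>J (T g) = T g\<close> is read off.\<close>
  define U where "U h = J (S (J h))" for h
  have U: "U h = h - (r h + r' h - r' (r h))" for h
    by (simp add: U_def Sdef J.diff J.add J r_def r'_def)
  have US: "U (S h) = S (U h)" for h
    by (simp add: U Sr S.diff S.add)
  define g where "g = f + J f - a (J f)"
  have Jg: "J g = g"
    using symbol(2) by (simp add: g_def J.add J.diff J r'_def)
  have Ug: "U g = S g"
    unfolding U Sdef[of g]
    by (simp add: g_def r_simps a.add a.diff a'.add a'.diff symbol comm flip: symbol)
       (simp add: comm symbol algebra_simps)
  have UTg: "U (T g) = g"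
    using Tcomm[of U, OF US, of g] by (simp add: Ug TS)
  have "S (J (T g)) = g"
    using arg_cong[OF UTg, of J] by (simp add: U_def J Jg)
  then have JTg: "J (T g) = T g" by (metis TS)
  define p where "p h = h - x' (T (x h))" for h
  have px': "p (x' h) = 0" for h
    using TS[of h] by (simp add: p_def S_def)
  have xp: "x (p h) = 0" for h
    using ST[of "x h"] by (simp add: p_def x.diff S_def)
  have pbl: "bounded_linear p"
    unfolding p_def[abs_def]
    by (rule bounded_linear_sub[OF bounded_linear_ident
          bounded_linear_compose[OF xbl(2) bounded_linear_compose[OF Tbl xbl(1)]]])
  interpret p: bounded_linear p by (rule pbl)
  \<comment> \<open>The identity \<open>x (p h) = 0\<close> does the work of self-adjointness and
    idempotence of \<open>p\<close>. Since \<open>x (J f) = g - f\<close>, what remains can be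
    reduced to inner products with \<open>T g\<close>.\<close>
  have "(norm (p (J f)))\<^sup>2 = inner (p (J f)) (J f) - inner (p (J f)) (x' (T (x (J f))))"
    unfolding power2_norm_eq_inner inner_diff_right[symmetric] by (rule arg_cong[OF p_def])
  also have "inner (p (J f)) (x' (T (x (J f)))) = 0"
    by (simp add: xp flip: xadj)
  also have "inner (p (J f)) (J f) = inner f f - inner (T (g - f)) (g - f)"
  proof -
    have "x (J f) = g - f" by (simp add: x_def g_def)
    then show ?thesis by (simp add: p_def inner_diff_left J xadj')
  qed
  also have "inner (T (g - f)) (g - f) = inner (T g) g - 2 * inner (T g) f + inner (T f) f"
    by (simp add: T.diff inner_diff_left inner_diff_right Tsym[of f g] inner_commute[of f])
  also have "inner (T f) f = inner f f + inner (T g) (a (J f))"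
  proof -
    \<comment> \<open>In the application \<open>r g = g * f\<close>, and \<open>1 - S\<close> is
      left convolution by \<open>g\<close>, whence \<open>f - S f = r g\<close>. Applying
      \<open>T\<close> shows that \<open>T - 1\<close> acts on \<open>f\<close> as left convolution
      by \<open>T g\<close>.\<close>
    have "r g = a f + a' f - a (a' f)"
      by (simp add: g_def r_simps symbol comm)
    then have "f = S f + r g" by (simp add: Sdef)
    then have "T f = f + T (r g)" by (metis TS T.add)
    also have "T (r g) = r (T g)" by (rule Tcomm[of r, OF Sr(1), symmetric])
    finally have "inner (T f) f = inner f f + inner (r (T g)) f" by (simp add: inner_add_left)
    \<comment> \<open>The adjoint of \<open>r\<close> is \<open>r'\<close>, since \<open>J\<close>
      preserves inner products and \<open>a'\<close> is the adjoint of \<open>a\<close>.\<close>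
    also have "inner (r (T g)) f = inner (T g) (r' f)"
    proof -
      have "inner (r (T g)) f = inner (J (r (T g))) (J f)" by (simp add: J)
      also have "\<dots> = inner (J (T g)) (a (J f))" by (simp add: r_def J inner_commute[of _ "J f"] adj[symmetric] inner_commute)
      also have "\<dots> = inner (J (J (T g))) (r' f)" by (simp only: r'_def J(3))
      finally show ?thesis by (simp add: J)
    qed
    finally show ?thesis by (simp add: symbol)
  qed
  also have "inner f f - (inner (T g) g - 2 * inner (T g) f + (inner f f + inner (T g) (a (J f)))) - 0
      = inner (T g) f - inner (T g) (J f)"
    by (simp add: g_def[THEN arg_cong[of _ _ "inner (T g)"]] inner_add_right inner_diff_right)
  also have "inner (T g) (J f) = inner (T g) f"
    using J(3)[of "T g" "J f"] by (simp add: J JTg)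
  finally have pJf: "p (J f) = 0" by simp
  \<comment> \<open>As \<open>p\<close> kills the range of \<open>x'\<close>, it satisfies
    \<open>p h = p (a' h)\<close>. On \<open>D\<close> this is \<open>p (R (J f))\<close>, and
    \<open>R\<close> commutes with \<open>p\<close> because it commutes with \<open>a\<close>,
    \<open>a'\<close> and hence with \<open>T\<close>.\<close>
  have "p h = 0" if hD: "h \<in> D" for h
  proof -
    obtain R where R: "linear R" "\<And>u. a (R u) = R (a u)" "\<And>u. a' (R u) = R (a' u)" "a' h = R (J f)"
      using D(2)[OF hD] by blast
    have "R (x u) = x (R u)" "R (x' u) = x' (R u)" "R (T u) = T (R u)" for u
      using Tcomm[of R, OF Scomm[OF R(1-3)]] by (simp_all add: x_def x'_def linear_diff[OF R(1)] R(2,3))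
    then have "R (p u) = p (R u)" for u
      by (simp add: p_def linear_diff[OF R(1)])
    from this[of "J f"] have "p (a' h) = 0" by (simp add: R(4) pJf linear_0[OF R(1)])
    moreover have "p h = p (x' h) + p (a' h)" by (simp add: x'_def flip: p.add)
    ultimately show ?thesis by (simp add: px')
  qed
  then have "closure D \<subseteq> {h. p h = 0}"
    by (intro closure_minimal closed_Collect_eq linear_continuous_on pbl continuous_on_const) auto
  then have "p h = 0" using D(1) by blast
  \<comment> \<open>Pairing this formula with \<open>h\<close> and using the bound
    \<open>1 / c\<^sup>2\<close> for \<open>T\<close> recovers the constant \<open>c\<close>
    itself.\<close>
  then have h: "h = x' (T (x h))" by (simp add: p_def)
  have "(norm h)\<^sup>2 = inner (x h) (T (x h))"
    using h by (simp add: power2_norm_eq_inner) (metis xadj inner_commute)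
  also have "\<dots> \<le> norm (x h) * norm (T (x h))" by (rule norm_cauchy_schwarz)
  finally have "c\<^sup>2 * (norm h)\<^sup>2 \<le> c\<^sup>2 * (norm (x h) * norm (T (x h)))"
    by (rule mult_left_mono) simp
  also have "\<dots> = norm (x h) * (c\<^sup>2 * norm (T (x h)))" by simp
  also have "\<dots> \<le> norm (x h) * norm (x h)"
    by (intro mult_left_mono Tnorm) simp
  finally have "(c * norm h)\<^sup>2 \<le> (norm (x h))\<^sup>2" by (simp add: power2_eq_square algebra_simps)
  then show ?thesis
    unfolding x_def by (rule power2_le_imp_le) simp
qed

section \<open>Direct finiteness\<close>

text \<open>Right convolution \<open>h \<mapsto> h * v\<close>, through \<open>(h * v)\<^sup>* = v\<^sup>* * h\<^sup>*\<close>.\<close>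

definition rho2 :: "('a::locally_compact_haar_group \<Rightarrow> complex) \<Rightarrow> 'a L2 \<Rightarrow> 'a L2"
  where "rho2 v h = L2_star (blinfun_apply (lambda2 (star v)) (L2_star h))"

section \<open>Commutation and adjoints of convolution operators\<close>

context
  assumes uni: "unimodular TYPE('a::locally_compact_haar_group)"
begin

lemma bounded_linear_rho2: "bounded_linear (rho2 (v :: 'a \<Rightarrow> complex))"
  unfolding rho2_def[abs_def]
  by (rule bounded_linear_compose[OF bounded_linear_L2_star[OF uni]
        bounded_linear_compose[OF blinfun.bounded_linear_right bounded_linear_L2_star[OF uni]]])

lemma rho2_abs_L2:
  fixes v :: "'a \<Rightarrow> complex"
  assumes "v \<in> Cc" "h \<in> Cc"
  shows "rho2 v (abs_L2 h) = abs_L2 (convolution h v)"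
  using star_Cc[OF assms(1)] star_Cc[OF assms(2)]
  by (simp add: rho2_def L2_star_abs[OF uni] lambda2_abs_L2[OF uni] Cc_square_integrable
      convolution_Cc convolution_star[OF uni] assms)

lemma lambda2_abs_L2_eq_rho2:
  fixes f :: "'a \<Rightarrow> complex"
  assumes "f \<in> Cc" "h \<in> Cc"
  shows "blinfun_apply (lambda2 f) (abs_L2 h) = rho2 h (abs_L2 f)"
  by (simp add: rho2_abs_L2 lambda2_abs_L2[OF uni] Cc_square_integrable assms)

lemma lambda2_rho2_commute:
  fixes f :: "'a \<Rightarrow> complex"
  assumes f: "f \<in> Cc" and v: "v \<in> Cc"
  shows "blinfun_apply (lambda2 f) (rho2 v h) = rho2 v (blinfun_apply (lambda2 f) h)"
proof (rule L2_dense_eqI[where h = h])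
  show "bounded_linear (\<lambda>h. blinfun_apply (lambda2 f) (rho2 v h))"
    by (rule bounded_linear_compose[OF blinfun.bounded_linear_right bounded_linear_rho2])
  show "bounded_linear (\<lambda>h. rho2 v (blinfun_apply (lambda2 f) h))"
    by (rule bounded_linear_compose[OF bounded_linear_rho2 blinfun.bounded_linear_right])
  show "blinfun_apply (lambda2 f) (rho2 v (abs_L2 h)) = rho2 v (blinfun_apply (lambda2 f) (abs_L2 h))"
    if "h \<in> Cc" for h
    using that by (simp add: rho2_abs_L2 lambda2_abs_L2[OF uni] Cc_square_integrable convolution_Cc
        convolution_assoc[OF uni] f v)
qed

lemma lambda2_adjoint:
  fixes f :: "'a \<Rightarrow> complex"
  assumes f: "f \<in> Cc"
  shows "inner (blinfun_apply (lambda2 f) u) v = inner u (blinfun_apply (lambda2 (star f)) v)"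
proof (rule L2_dense_eqI[where h = u])
  show "bounded_linear (\<lambda>u. inner (blinfun_apply (lambda2 f) u) v)"
    by (rule bounded_linear_compose[OF bounded_linear_inner_left blinfun.bounded_linear_right])
  show "bounded_linear (\<lambda>u. inner u (blinfun_apply (lambda2 (star f)) v))"
    by (rule bounded_linear_inner_left)
  fix h :: "'a \<Rightarrow> complex" assume h: "h \<in> Cc"
  show "inner (blinfun_apply (lambda2 f) (abs_L2 h)) v = inner (abs_L2 h) (blinfun_apply (lambda2 (star f)) v)"
  proof (rule L2_dense_eqI[where h = v])
    show "bounded_linear (\<lambda>v. inner (blinfun_apply (lambda2 f) (abs_L2 h)) v)"
      by (rule bounded_linear_inner_right)
    show "bounded_linear (\<lambda>v. inner (abs_L2 h) (blinfun_apply (lambda2 (star f)) v))"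
      by (rule bounded_linear_compose[OF bounded_linear_inner_right blinfun.bounded_linear_right])
    show "inner (blinfun_apply (lambda2 f) (abs_L2 h)) (abs_L2 k)
        = inner (abs_L2 h) (blinfun_apply (lambda2 (star f)) (abs_L2 k))" if k: "k \<in> Cc" for k
      using star_Cc[OF f] convolution_adjoint[OF uni f h k]
      by (simp add: lambda2_abs_L2[OF uni] Cc_square_integrable convolution_Cc inner_abs_L2 f h k)
  qed
qed

text \<open>Left and right convolutions commute by associativity, and \<open>f * h\<close> can be
  read as left convolution applied to \<open>h\<close> or right convolution applied to
  \<open>f\<close>. The latter reading of \<open>star f * h\<close> makes \<open>rho2 h\<close> the
  operator required for each \<open>h\<close> in the dense set.\<close>

lemma lambda2_lower_bound:
  fixes f :: "'a \<Rightarrow> complex"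
  assumes f: "f \<in> Cc" and c: "c > 0" "\<And>h. c * norm h \<le> norm (h - blinfun_apply (lambda2 (star f)) h)"
  shows "c * norm h \<le> norm (h - blinfun_apply (lambda2 f) h)"
proof -
  let ?a = "blinfun_apply (lambda2 f)" and ?a' = "blinfun_apply (lambda2 (star f))"
  have sf: "star f \<in> Cc" by (rule star_Cc[OF f])
  have r: "(\<lambda>h. L2_star (?a' (L2_star h))) = rho2 f" "(\<lambda>h. L2_star (?a (L2_star h))) = rho2 (star f)"
    by (simp_all add: rho2_def fun_eq_iff)
  have Jf: "L2_star (abs_L2 f) = abs_L2 (star f)"
    by (rule L2_star_abs[OF uni Cc_square_integrable[OF f]])
  show ?thesis
  proof (rule lower_bound_of_adjoint_lower_bound[where a = ?a and a' = ?a' and J = L2_star and f = "abs_L2 f"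
        and D = "abs_L2 ` Cc", unfolded r[THEN fun_cong], unfolded Jf])
    show "bounded_linear ?a" "bounded_linear ?a'" "bounded_linear (L2_star :: 'a L2 \<Rightarrow> 'a L2)"
      by (rule blinfun.bounded_linear_right bounded_linear_L2_star[OF uni])+
    show "inner (?a u) v = inner u (?a' v)" for u v by (rule lambda2_adjoint[OF f])
    show "L2_star (L2_star u) = u" "inner (L2_star u) (L2_star v) = inner u v" for u v :: "'a L2"
      by (rule L2_star_L2_star[OF uni] inner_L2_star[OF uni])+
    show "?a (rho2 f h) = rho2 f (?a h)" "?a (rho2 (star f) h) = rho2 (star f) (?a h)"
      "?a' (rho2 f h) = rho2 f (?a' h)" "?a' (rho2 (star f) h) = rho2 (star f) (?a' h)" for h
      by (rule lambda2_rho2_commute; fact f sf)+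
    show "?a (abs_L2 f) = rho2 f (abs_L2 f)" "?a (abs_L2 (star f)) = rho2 (star f) (abs_L2 f)"
      "?a' (abs_L2 f) = rho2 f (abs_L2 (star f))" "?a' (abs_L2 (star f)) = rho2 (star f) (abs_L2 (star f))"
      by (rule lambda2_abs_L2_eq_rho2; fact f sf)+
    show "closure (abs_L2 ` Cc) = (UNIV :: 'a L2 set)" by (rule closure_abs_L2_Cc)
    fix h :: "'a L2" assume "h \<in> abs_L2 ` Cc"
    then obtain h0 where h0: "h0 \<in> Cc" "h = abs_L2 h0" by blast
    show "\<exists>R. linear R \<and> (\<forall>u. ?a (R u) = R (?a u)) \<and> (\<forall>u. ?a' (R u) = R (?a' u)) \<and> ?a' h = R (abs_L2 (star f))"
      using bounded_linear.linear[OF bounded_linear_rho2[of h0]] lambda2_rho2_commute[OF f h0(1)]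
        lambda2_rho2_commute[OF sf h0(1)] lambda2_abs_L2_eq_rho2[OF sf h0(1)] h0(2) by blast
  qed (fact c)+
qed

end

theorem theorem1p1:
  assumes "unimodular TYPE('a::locally_compact_haar_group)"
  shows "directly_finite blinfun_compose
    (reduced_group_Cstar :: ('a L2 \<Rightarrow>\<^sub>L 'a L2) set)"
  unfolding directly_finite_def
proof (intro ballI impI)
  fix a b :: "'a L2 \<Rightarrow>\<^sub>L 'a L2"
  assume "a \<in> reduced_group_Cstar" and ab: "circ blinfun_compose a b = 0"
  then have a: "a \<in> closure (lambda2 ` Cc)" by (simp add: reduced_group_Cstar_def)
  define x y where "x h = h - a h" and "y h = h - b h" for h
  have xy: "x (y h) = h" for h
  proof -
    have "blinfun_apply (circ blinfun_compose a b) h = 0" by (simp add: ab)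
    then show ?thesis
      by (simp add: circ_def x_def y_def blinfun.bilinear_simps algebra_simps)
  qed
  define M where "M = 1 + norm b"
  have M: "M > 0" by (simp add: M_def add_pos_nonneg)
  have yM: "norm (y h) \<le> M * norm h" for h
    using norm_triangle_ineq4[of h "b h"] norm_blinfun[of b h] by (simp add: y_def M_def algebra_simps)
  \<comment> \<open>The right inverse \<open>y\<close> gives the adjoint of \<open>x\<close> the
    lower bound \<open>1 / M\<close>. Half of it survives an approximation within
    \<open>c / 2\<close>, because the error term then costs only a quarter of
    \<open>norm h * norm h\<close>.\<close>
  define c where "c = 1 / (2 * M)"
  have c: "c > 0" using M by (simp add: c_def)
  obtain f where f: "f \<in> Cc" "norm (lambda2 f - a) < c / 2"
    using a[unfolded closure_approachable, rule_format, of "c / 2"] c by (auto simp: dist_norm)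
  have fa: "norm (blinfun_apply (lambda2 f - a) h) \<le> c / 2 * norm h" for h
    using norm_blinfun[of "lambda2 f - a" h] f(2) by (meson less_imp_le mult_right_mono norm_ge_zero order_trans)
  have "c * norm h \<le> norm (h - lambda2 (star f) h)" for h
  proof -
    let ?z = "h - lambda2 (star f) h"
    have "norm h * norm h = inner h (x (y h))"
      by (simp add: xy power2_norm_eq_inner flip: power2_eq_square)
    also have "x (y h) = (y h - lambda2 f (y h)) + (lambda2 f - a) (y h)"
      by (simp add: x_def blinfun.diff_left)
    also have "inner h \<dots> = inner ?z (y h) + inner h ((lambda2 f - a) (y h))"
      using lambda2_adjoint[OF assms f(1), of "y h" h]
      by (simp add: inner_add_right inner_diff_right inner_diff_left inner_commute)
    also have "\<dots> \<le> norm ?z * norm (y h) + norm h * norm ((lambda2 f - a) (y h))"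
      by (intro add_mono norm_cauchy_schwarz)
    also have "\<dots> \<le> norm ?z * (M * norm h) + norm h * (c / 2 * (M * norm h))"
      using yM[of h] fa[of "y h"] c
      by (intro add_mono mult_left_mono order_trans[OF fa] mult_left_mono) auto
    also have "norm h * (c / 2 * (M * norm h)) = norm h * norm h / 4"
      using M by (simp add: c_def field_simps)
    finally have "norm h * norm h \<le> norm ?z * (M * norm h) + norm h * norm h / 4" .
    moreover have "0 \<le> norm h * norm h" by simp
    ultimately have "norm h * norm h \<le> 2 * (norm ?z * (M * norm h))" by linarith
    then have "norm h * (c * norm h) \<le> norm h * norm ?z"
      using M by (simp add: c_def field_simps)
    then show ?thesis by (cases "h = 0") auto
  qed
  note lower = lambda2_lower_bound[OF assms f(1) c this]
  \<comment> \<open>The perturbation, at most \<open>c / 2\<close>, is too small to cancel the lower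
    bound \<open>c\<close>, whose value does not depend on \<open>f\<close>.\<close>
  have x_inj: "h = 0" if "x h = 0" for h
  proof -
    have "h - lambda2 f h = - ((lambda2 f - a) h)"
      using that by (simp add: x_def blinfun.diff_left)
    then have "c * norm h \<le> c / 2 * norm h"
      using lower[of h] fa[of h] by simp
    then show ?thesis using c by (cases "h = 0") auto
  qed
  \<comment> \<open>Since \<open>x (y (x h)) = x h\<close>, injectivity makes the right inverse
    two-sided.\<close>
  have yx: "y (x h) = h" for h
  proof -
    have "x (y (x h) - h) = x (y (x h)) - x h" by (simp add: x_def blinfun.diff_right)
    then show ?thesis using x_inj[of "y (x h) - h"] by (simp add: xy)
  qed
  show "circ blinfun_compose b a = 0"
  proof (rule blinfun_eqI)
    fix h
    show "blinfun_apply (circ blinfun_compose b a) h = blinfun_apply 0 h"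
      using yx[of h] by (simp add: circ_def x_def y_def blinfun.bilinear_simps algebra_simps)
  qed
qed

end
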